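(* Let $R=\Bbbk[z][x,y;\sigma,a]$ be a classical generalized Weyl algebra with $\sigma(z)=z-1$, where $a\in\Bbbk[z]$ is a monic reflective polynomial of degree $n\ge 3$ with $0$ as a root. Let $H$ be a nontrivial finite subgroup of the group $\operatorname{Aut}_{\mathrm{fl}}(R)$ of filtered automorphisms of $R$. If $n$ is even, then one of the following holds: (1) $H=\langle\Theta_\beta\circ\Omega\rangle$ for some $\beta\in\Bbbk^\times$ and $H\cong C_2$; (2) $H=\langle\Theta_\lambda\rangle$ for some $\lambda\in\Bbbk^\times$ an $m$th root of unity and $H\cong C_m$; or (3) $H=\langle\Theta_\beta\circ\Omega,\Theta_\lambda\rangle$ for some $\beta,\lambda\in\Bbbk^\times$ with $\lambda$ an $m$th root of unity and $H\cong D_{2m}$, the dihedral group of order $2m$. If $n$ is odd, then one of the following holds: (1) $H=\langle\Theta_\beta\circ\Omega\rangle$ for some $\beta\in\Bbbk^\times$ and $H\cong C_4$; (2) $H=\langle\Theta_\lambda\rangle$ for some $\lambda\in\Bbbk^\times$ an $m$th root of unity and $H\cong C_m$; or (3) $H=\langle\Theta_\beta\circ\Omega,\Theta_\lambda\rangle$ for some $\beta,\lambda\in\Bbbk^\times$ with $\lambda$ a $2m$th root of unity and $H\cong\operatorname{Dic}_m$, the binary dihedral group of order $4m$. (Here $m$ denotes some positive integer in each case.)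
   Context: $\Bbbk$ is an algebraically closed field of characteristic zero; all algebras are $\Bbbk$-algebras. $C_m$ is the cyclic group of order $m$. Classical GWA: $R=\Bbbk[z][x,y;\sigma,a]$, with $\sigma(z)=z-1$, is the ring obtained by adjoining to $\Bbbk[z]$ the variables $x,y$ subject to $xy=\sigma(a)$, $yx=a$, $xd=\sigma(d)x$, $yd=\sigma^{-1}(d)y$ for all $d\in\Bbbk[z]$. Standard filtration: the filtration on $R$ defined by $\deg x=\deg y=n$, $\deg z=2$. A filtered automorphism is a $\Bbbk$-algebra automorphism $\phi$ with $\deg(\phi(r))=\deg(r)$ for all $r\in R$. Reflective: $a$ is reflective if there is $\rho\in\Bbbk$ with $a(\rho-z)=(-1)^na(z)$. Maps: $\Theta_\beta$ ($\beta\in\Bbbk^\times$) is the automorphism $x\mapsto\beta x$, $y\mapsto\beta^{-1}y$, $z\mapsto z$; $\Omega$ is the automorphism $x\mapsto y$, $y\mapsto(-1)^nx$, $z\mapsto1+\rho-z$. Composition is right-to-left: $(\phi\circ\psi)(r)=\phi(\psi(r))$. *)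

theory Defs
  imports
    "HOL-Algebra.Algebra"
    "HOL-Algebra.Algebraic_Closure_Type"
    "HOL-Library.Poly_Mapping"
    "HOL-Computational_Algebra.Polynomial"
begin

section \<open>The free algebra on three generators\<close>

datatype gen = GX | GY | GZ

datatype word = Word (letters: "gen list")

text \<open>
  Words form the free monoid on the generators, written additively so that
  \<^typ>\<open>word \<Rightarrow>\<^sub>0 'k\<close>, with the convolution product of
  \<^theory>\<open>HOL-Library.Poly_Mapping\<close>, is the (noncommutative) free algebra.
\<close>

instantiation word :: monoid_add
begin

definition zero_word :: word where
  "zero_word = Word []"

definition plus_word :: "word \<Rightarrow> word \<Rightarrow> word" where
  "plus_word u v = Word (letters u @ letters v)"

instance
  by standard (simp_all add: zero_word_def plus_word_def)

end

type_synonym 'k free_alg = "word \<Rightarrow>\<^sub>0 'k"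

definition free_scalar :: "'k::field \<Rightarrow> 'k free_alg" where
  "free_scalar c = Poly_Mapping.single 0 c"

definition free_gen :: "gen \<Rightarrow> 'k::field free_alg" where
  "free_gen g = Poly_Mapping.single (Word [g]) 1"

abbreviation free_x :: "'k::field free_alg" where "free_x \<equiv> free_gen GX"
abbreviation free_y :: "'k::field free_alg" where "free_y \<equiv> free_gen GY"
abbreviation free_z :: "'k::field free_alg" where "free_z \<equiv> free_gen GZ"

text \<open>The inclusion of \<open>k[z]\<close> into the free algebra.\<close>

definition free_poly :: "'k::field poly \<Rightarrow> 'k free_alg" where
  "free_poly d = (\<Sum>i\<le>degree d. free_scalar (coeff d i) * free_z ^ i)"


section \<open>The classical generalized Weyl algebra\<close>

definition shift :: "'k::field poly \<Rightarrow> 'k poly" where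
  "shift d = pcompose d [:- 1, 1:]"

definition unshift :: "'k::field poly \<Rightarrow> 'k poly" where
  "unshift d = pcompose d [:1, 1:]"

lemma unshift_shift: "unshift (shift d) = d" and shift_unshift: "shift (unshift d) = d"
  by (simp_all add: shift_def unshift_def flip: pcompose_assoc)
     (simp_all add: pcompose_pCons)

definition gwa_relators :: "'k::field poly \<Rightarrow> 'k free_alg set" where
  "gwa_relators a =
     {free_x * free_y - free_poly (shift a), free_y * free_x - free_poly a}
     \<union> range (\<lambda>d. free_x * free_poly d - free_poly (shift d) * free_x)
     \<union> range (\<lambda>d. free_y * free_poly d - free_poly (unshift d) * free_y)"

text \<open>\<open>Idl\<close> is the two-sided ideal generated by a set.\<close>

definition gwa_ideal :: "'k::field poly \<Rightarrow> 'k free_alg set" where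
  "gwa_ideal a = Idl\<^bsub>ring_of_type_algebra\<^esub> (gwa_relators a)"

definition gwa :: "'k::field poly \<Rightarrow> 'k free_alg set ring" where
  "gwa a = ring_of_type_algebra Quot gwa_ideal a"

definition gwa_class :: "'k::field poly \<Rightarrow> 'k free_alg \<Rightarrow> 'k free_alg set" where
  "gwa_class a f = gwa_ideal a +>\<^bsub>ring_of_type_algebra\<^esub> f"


section \<open>Standard filtration and filtered automorphisms\<close>

fun gen_weight :: "nat \<Rightarrow> gen \<Rightarrow> nat" where
  "gen_weight n GX = n"
| "gen_weight n GY = n"
| "gen_weight n GZ = 2"

definition word_weight :: "nat \<Rightarrow> word \<Rightarrow> nat" where
  "word_weight n w = (\<Sum>g\<leftarrow>letters w. gen_weight n g)"

definition gwa_filtration :: "'k::field poly \<Rightarrow> nat \<Rightarrow> 'k free_alg set set" where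
  "gwa_filtration a i =
     gwa_class a ` {f. \<forall>w\<in>Poly_Mapping.keys f. word_weight (degree a) w \<le> i}"

text \<open>
  The zero element gets degree 0 rather than \<open>-\<infinity>\<close>; this makes no difference to which
  bijective additive maps preserve the degree, since those fix zero.
\<close>

definition gwa_deg :: "'k::field poly \<Rightarrow> 'k free_alg set \<Rightarrow> nat" where
  "gwa_deg a r = (LEAST i. r \<in> gwa_filtration a i)"

text \<open>
  As in \<^theory>\<open>HOL-Algebra.Bij\<close>, automorphisms are extensional functions on the carrier and
  the product of \<^const>\<open>BijGroup\<close> is right-to-left composition. A ring homomorphism is
  \<open>k\<close>-linear iff it fixes the image of \<open>k\<close>.
\<close>

definition gwa_alg_auts :: "'k::field poly \<Rightarrow> ('k free_alg set \<Rightarrow> 'k free_alg set) set" where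
  "gwa_alg_auts a =
     {\<phi> \<in> Bij (carrier (gwa a)). \<phi> \<in> ring_hom (gwa a) (gwa a) \<and>
        (\<forall>c. \<phi> (gwa_class a (free_scalar c)) = gwa_class a (free_scalar c))}"

definition filtered_Aut :: "'k::field poly \<Rightarrow> ('k free_alg set \<Rightarrow> 'k free_alg set) monoid" where
  "filtered_Aut a = BijGroup (carrier (gwa a))
     \<lparr>carrier := {\<phi> \<in> gwa_alg_auts a. \<forall>r\<in>carrier (gwa a). gwa_deg a (\<phi> r) = gwa_deg a r}\<rparr>"


section \<open>Reflections and the automorphisms Theta and Omega\<close>

text \<open>A polynomial is reflective iff it is reflective about some \<open>\<rho>\<close>.\<close>

definition reflective_about :: "'k::field poly \<Rightarrow> 'k \<Rightarrow> bool" where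
  "reflective_about a \<rho> \<longleftrightarrow> pcompose a [:\<rho>, - 1:] = smult ((- 1) ^ degree a) a"

definition gwa_aut_with ::
  "'k::field poly \<Rightarrow> 'k free_alg \<Rightarrow> 'k free_alg \<Rightarrow> 'k free_alg
    \<Rightarrow> 'k free_alg set \<Rightarrow> 'k free_alg set" where
  "gwa_aut_with a fx fy fz =
     (THE \<phi>. \<phi> \<in> gwa_alg_auts a \<and> \<phi> (gwa_class a free_x) = gwa_class a fx \<and>
        \<phi> (gwa_class a free_y) = gwa_class a fy \<and> \<phi> (gwa_class a free_z) = gwa_class a fz)"

definition Theta :: "'k::field poly \<Rightarrow> 'k \<Rightarrow> 'k free_alg set \<Rightarrow> 'k free_alg set" where
  "Theta a \<beta> =
     gwa_aut_with a (free_scalar \<beta> * free_x) (free_scalar (inverse \<beta>) * free_y) free_z"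

text \<open>An automorphism only when \<open>a\<close> is reflective about \<open>\<rho>\<close>.\<close>

definition Omega :: "'k::field poly \<Rightarrow> 'k \<Rightarrow> 'k free_alg set \<Rightarrow> 'k free_alg set" where
  "Omega a \<rho> =
     gwa_aut_with a free_y (free_scalar ((- 1) ^ degree a) * free_x)
       (free_scalar (1 + \<rho>) - free_z)"

definition Theta_Omega ::
  "'k::field poly \<Rightarrow> 'k \<Rightarrow> 'k \<Rightarrow> 'k free_alg set \<Rightarrow> 'k free_alg set" where
  "Theta_Omega a \<rho> \<beta> = compose (carrier (gwa a)) (Theta a \<beta>) (Omega a \<rho>)"


section \<open>Dihedral and binary dihedral groups\<close>

text \<open>
  The dihedral group of order \<open>2m\<close>, for \<open>m \<ge> 1\<close> (so \<open>C\<^sub>2\<close> for \<open>m = 1\<close> and the Klein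
  four-group for \<open>m = 2\<close>): the pair \<open>(i, e)\<close> stands for \<open>r\<^sup>i s\<^sup>e\<close>, where
  \<open>r\<^sup>m = s\<^sup>2 = 1\<close> and \<open>s r s\<^sup>-\<^sup>1 = r\<^sup>-\<^sup>1\<close>.
\<close>

definition dihedral_group :: "nat \<Rightarrow> (int \<times> nat) monoid" where
  "dihedral_group m =
     \<lparr>carrier = {0..<int m} \<times> {0, 1},
      monoid.mult = (\<lambda>(i, e) (j, f). ((i + (- 1) ^ e * j) mod int m, (e + f) mod 2)),
      one = (0, 0)\<rparr>"

text \<open>
  The binary dihedral group of order \<open>4m\<close>, for \<open>m \<ge> 1\<close> (so \<open>C\<^sub>4\<close> for \<open>m = 1\<close>): the pair
  \<open>(i, e)\<close> stands for \<open>r\<^sup>i s\<^sup>e\<close>, where \<open>r\<^sup>2\<^sup>m = 1\<close>, \<open>s\<^sup>2 = r\<^sup>m\<close> and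
  \<open>s r s\<^sup>-\<^sup>1 = r\<^sup>-\<^sup>1\<close>. The summand \<open>m e f\<close> accounts for \<open>s\<^sup>2 = r\<^sup>m\<close>.
\<close>

definition binary_dihedral_group :: "nat \<Rightarrow> (int \<times> nat) monoid" where
  "binary_dihedral_group m =
     \<lparr>carrier = {0..<2 * int m} \<times> {0, 1},
      monoid.mult = (\<lambda>(i, e) (j, f).
        ((i + (- 1) ^ e * j + int m * int e * int f) mod (2 * int m), (e + f) mod 2)),
      one = (0, 0)\<rparr>"

lemma group_dihedral_group:
  assumes "m > 0"
  shows "group (dihedral_group m)"
proof (rule groupI, goal_cases)
  case (3 p q t)
  then show ?case
    by (auto simp: dihedral_group_def mod_simps algebra_simps)
next
  case (5 p)
  have "\<exists>q\<in>carrier (dihedral_group m). monoid.mult (dihedral_group m) q p = (0, 0)"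
  proof (cases "snd p = 0")
    case True
    then show ?thesis using 5 assms
      by (intro bexI[of _ "((- fst p) mod int m, 0)"]) (auto simp: dihedral_group_def mod_simps)
  next
    case False
    then show ?thesis using 5 assms
      by (intro bexI[of _ p]) (auto simp: dihedral_group_def)
  qed
  then show ?case by (simp add: dihedral_group_def)
qed (use assms in \<open>auto simp: dihedral_group_def\<close>)

lemma card_dihedral_group: "card (carrier (dihedral_group m)) = 2 * m"
  by (simp add: dihedral_group_def)

lemma group_binary_dihedral_group:
  assumes "m > 0"
  shows "group (binary_dihedral_group m)"
proof (rule groupI, goal_cases)
  case (3 p q t)
  have aux1: "(k + u mod N - v) mod N = (k + u - v) mod N" for k u v N :: int
    using mod_add_left_eq[of u N "k - v"] by (simp add: algebra_simps)
  have aux2: "(u + v + int m - w) mod (int m * 2) = (u + v - (w + int m)) mod (int m * 2)" for u v w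
    using mod_add_self2[of "u + v - (w + int m)" "int m * 2"] by (simp add: algebra_simps)
  from 3 aux2 show ?case
    by (auto simp: binary_dihedral_group_def mod_simps algebra_simps aux1)
next
  case (5 p)
  have aux: "((x + int m) mod (2 * int m) - x + int m) mod (2 * int m) = 0" for x
    using mod_add_left_eq[of "x + int m" "2 * int m" "int m - x"] by (simp add: algebra_simps)
  have "\<exists>q\<in>carrier (binary_dihedral_group m). monoid.mult (binary_dihedral_group m) q p = (0, 0)"
  proof (cases "snd p = 0")
    case True
    then show ?thesis using 5 assms
      by (intro bexI[of _ "((- fst p) mod (2 * int m), 0)"])
        (auto simp: binary_dihedral_group_def mod_simps)
  next
    case False
    then show ?thesis using 5 assms
      by (intro bexI[of _ "((fst p + int m) mod (2 * int m), 1)"])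
        (auto simp: binary_dihedral_group_def aux)
  qed
  then show ?case by (simp add: binary_dihedral_group_def)
qed (use assms in \<open>auto simp: binary_dihedral_group_def\<close>)

lemma card_binary_dihedral_group: "card (carrier (binary_dihedral_group m)) = 4 * m"
  by (simp add: binary_dihedral_group_def)

end

theory Submission
  imports Defs "HOL-Library.Function_Algebras"
begin

text \<open>
  The filtration pins down a filtered automorphism \<open>\<phi>\<close> almost completely. As \<open>x\<close> and \<open>y\<close> have
  degree \<open>n \<ge> 3\<close>, the elements of degree at most \<open>2\<close> are spanned by \<open>1\<close> and \<open>z\<close>, so
  \<open>\<phi> z = \<gamma> + \<alpha> z\<close>; and the elements of degree at most \<open>n\<close> have the form \<open>p(z) + b x + c y\<close>, which
  is therefore the form of \<open>\<phi> x\<close> and \<open>\<phi> y\<close>. Comparing coefficients in the relations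
  \<open>x z = (z - 1) x\<close> and \<open>y z = (z + 1) y\<close> leaves two possibilities (\<open>z_eigenvector\<close>): either
  \<open>\<alpha> = 1\<close> and \<open>\<phi>\<close> rescales \<open>x\<close> and \<open>y\<close>, or \<open>\<alpha> = -1\<close> and \<open>\<phi>\<close> swaps them up to scalars. The
  relation \<open>y x = a\<close> then makes \<open>a\<close> invariant under a translation by \<open>\<gamma>\<close>, respectively by
  \<open>\<gamma> - (1 + \<rho>)\<close>. A nonzero polynomial with a root has no translation symmetry in characteristic zero, so
  \<open>\<phi>\<close> is some \<open>\<Theta>\<^sub>\<beta>\<close> or some \<open>\<Theta>\<^sub>\<beta> \<circ> \<Omega>\<close> (\<open>filtered_Aut_cases\<close>).

  Comparing coefficients requires that \<open>1\<close>, \<open>x\<close>, \<open>y\<close> are independent over \<open>k[z]\<close> in the algebra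
  given by generators and relations. This is read off from its action on formal skew Laurent series,
  in which \<open>x\<close> is the variable \<open>t\<close> and \<open>y\<close> is \<open>a t\<^sup>-\<^sup>1\<close> (\<open>laurent_kills_ideal\<close>).

  Composition follows the rules \<open>\<Theta>\<^sub>\<beta> \<Theta>\<^sub>\<gamma> = \<Theta>\<^sub>\<beta>\<^sub>\<gamma>\<close>, \<open>\<Omega> \<Theta>\<^sub>\<gamma> = \<Theta>\<^sub>1\<^sub>/\<^sub>\<gamma> \<Omega>\<close> and \<open>\<Omega>\<^sup>2 = \<Theta>\<^sub>\<epsilon>\<close> with
  \<open>\<epsilon> = (-1)\<^sup>n\<close>. In a finite group \<open>H\<close> of filtered automorphisms the scalars \<open>\<beta>\<close> with \<open>\<Theta>\<^sub>\<beta> \<in> H\<close> form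
  a finite subgroup of the multiplicative group of the field, hence a cyclic one
  (\<open>finite_mult_subgroup_cyclic\<close>), generated by some \<open>\<mu>\<close>. Either \<open>H = \<langle>\<Theta>\<^sub>\<mu>\<rangle>\<close>, or \<open>H\<close> contains some
  \<open>s = \<Theta>\<^sub>\<beta> \<circ> \<Omega>\<close>, and then \<open>H = \<langle>s, \<Theta>\<^sub>\<mu>\<rangle>\<close> where \<open>s\<close> inverts \<open>\<Theta>\<^sub>\<mu>\<close> and \<open>s\<^sup>2 = \<Theta>\<^sub>\<epsilon>\<close>. These are the
  relations of a dihedral group for even \<open>n\<close>. For odd \<open>n\<close> the element \<open>s\<^sup>2 = \<Theta>\<^sub>-\<^sub>1\<close> is the
  involution in \<open>\<langle>\<Theta>\<^sub>\<mu>\<rangle>\<close>, and the relations are those of a binary dihedral group.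
\<close>

section \<open>Actions of the free algebra\<close>

lemma poly_mapping_induct_keys:
  fixes f :: "'a \<Rightarrow>\<^sub>0 'b::comm_monoid_add"
  assumes "P 0" and "\<And>g w c. w \<in> Poly_Mapping.keys f \<Longrightarrow> P g \<Longrightarrow> P (Poly_Mapping.single w c + g)"
  shows "P f"
  using assms
proof (induction f rule: update_induct)
  case const
  then show ?case by blast
next
  case (update f w c)
  have keys: "Poly_Mapping.keys (Poly_Mapping.update w c f) = insert w (Poly_Mapping.keys f)"
    using update.hyps by (auto simp: in_keys_iff lookup_update split: if_splits)
  have "Poly_Mapping.update w c f = Poly_Mapping.single w c + f"
    using update.hyps
    by (intro poly_mapping_eqI) (auto simp: lookup_update lookup_add lookup_single in_keys_iff)
  moreover have "P f"
    using update.prems keys by (intro update.IH) auto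
  ultimately show ?case
    using update.prems(2) keys by simp
qed

lemma poly_mapping_induct_single [case_names zero add]:
  fixes f :: "'a \<Rightarrow>\<^sub>0 'b::comm_monoid_add"
  assumes "P 0" and "\<And>f w c. P f \<Longrightarrow> P (Poly_Mapping.single w c + f)"
  shows "P f"
  using assms by (rule poly_mapping_induct_keys)

text \<open>
  The free algebra acts on a vector space as soon as each generator does. Two instances carry the
  development: left multiplication by prescribed elements, which yields substitutions, and the
  operators of the skew Laurent representation.
\<close>

locale free_action = vector_space scale
  for scale :: "'k::field \<Rightarrow> 'v::ab_group_add \<Rightarrow> 'v" (infixr \<open>*s\<close> 75) +
  fixes op :: "gen \<Rightarrow> 'v \<Rightarrow> 'v"
  assumes op_add: "op g (u + v) = op g u + op g v"
    and op_scale: "op g (c *s v) = c *s op g v"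
begin

definition word_act :: "word \<Rightarrow> 'v \<Rightarrow> 'v" where
  "word_act w = foldr op (letters w)"

definition act :: "'k free_alg \<Rightarrow> 'v \<Rightarrow> 'v" where
  "act f v = (\<Sum>w\<in>Poly_Mapping.keys f. Poly_Mapping.lookup f w *s word_act w v)"

lemma word_act_add: "word_act w (u + v) = word_act w u + word_act w v"
proof -
  have "foldr op gs (u + v) = foldr op gs u + foldr op gs v" for gs
    by (induction gs) (simp_all add: op_add)
  then show ?thesis by (simp add: word_act_def)
qed

lemma word_act_scale: "word_act w (c *s v) = c *s word_act w v"
proof -
  have "foldr op gs (c *s v) = c *s foldr op gs v" for gs
    by (induction gs) (simp_all add: op_scale)
  then show ?thesis by (simp add: word_act_def)
qed

lemma word_act_plus: "word_act (w + w') v = word_act w (word_act w' v)"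
  by (simp add: word_act_def plus_word_def)

lemma act_zero [simp]: "act 0 v = 0"
  by (simp add: act_def)

lemma act_single: "act (Poly_Mapping.single w c) v = c *s word_act w v"
  by (simp add: act_def)

lemma act_plus: "act (f + g) v = act f v + act g v"
  unfolding act_def by (rule setsum_keys_plus_distrib) (simp_all add: scale_left_distrib)

lemma act_uminus: "act (- f) v = - act f v"
  using act_plus[of f "- f" v] by (simp add: eq_neg_iff_add_eq_0 add.commute)

lemma act_diff: "act (f - g) v = act f v - act g v"
  using act_plus[of f "- g" v] by (simp add: act_uminus)

lemma act_vec_add: "act f (u + v) = act f u + act f v"
  by (induction f rule: poly_mapping_induct_single)
    (simp_all add: act_plus act_single word_act_add scale_right_distrib algebra_simps)

lemma act_vec_zero [simp]: "act f 0 = 0"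
  using act_vec_add[of f 0 0] by simp

lemma act_times: "act (f * g) v = act f (act g v)"
proof (induction f rule: poly_mapping_induct_single)
  case (add f w c)
  have "act (Poly_Mapping.single w c * g) v = c *s word_act w (act g v)"
  proof (induction g rule: poly_mapping_induct_single)
    case zero
    then show ?case
      using word_act_scale[of w 0 0] by simp
  next
    case (add g w' c')
    then show ?case
      by (simp add: distrib_left act_plus mult_single act_single word_act_plus word_act_add
          word_act_scale scale_right_distrib)
  qed
  with add show ?case
    by (simp add: distrib_right act_plus act_single)
qed simp

lemma act_scalar [simp]: "act (free_scalar c) v = c *s v"
  by (simp add: free_scalar_def act_single word_act_def zero_word_def)

lemma act_gen [simp]: "act (free_gen g) v = op g v"
  by (simp add: free_gen_def act_single word_act_def)

lemma act_one [simp]: "act 1 v = v"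
  using act_scalar[of 1 v] by (simp add: free_scalar_def flip: single_one)

end

lemma free_scalar_add: "free_scalar (b + c) = free_scalar b + free_scalar c"
  by (simp add: free_scalar_def single_add)

lemma free_scalar_uminus: "free_scalar (- c) = - free_scalar c"
  by (simp add: free_scalar_def single_uminus)

lemma free_scalar_mult: "free_scalar (b * c) = free_scalar b * free_scalar c"
  by (simp add: free_scalar_def mult_single)

lemma free_scalar_0 [simp]: "free_scalar 0 = 0"
  by (simp add: free_scalar_def)

lemma free_scalar_1 [simp]: "free_scalar 1 = 1"
  by (simp add: free_scalar_def)

lemma free_scalar_central: "f * free_scalar c = free_scalar c * f"
  by (induction f rule: poly_mapping_induct_single)
    (simp_all add: distrib_left distrib_right free_scalar_def mult_single mult.commute)

text \<open>
  Used as a rewrite rule only for a fixed left factor: for an arbitrary one, two scalars would be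
  exchanged forever.
\<close>

lemma free_scalar_left_commute: "f * (free_scalar c * g) = free_scalar c * (f * g)"
  by (metis free_scalar_central mult.assoc)

text \<open>
  Horner's rule, which turns every statement about \<^const>\<open>free_poly\<close> into an induction over
  coefficient lists.
\<close>

lemma free_poly_pCons: "free_poly (pCons c p) = free_scalar c + free_z * free_poly p"
proof (cases "p = 0")
  case True
  then show ?thesis by (simp add: free_poly_def)
next
  case False
  then show ?thesis
    by (simp add: free_poly_def sum.atMost_Suc_shift sum_distrib_left
        free_scalar_left_commute[of free_z] del: sum.atMost_Suc)
qed

lemma free_poly_0 [simp]: "free_poly 0 = 0"
  by (simp add: free_poly_def)

lemma free_poly_add: "free_poly (p + q) = free_poly p + free_poly q"
  by (induction p q rule: poly_induct2)
    (simp_all add: free_poly_pCons free_scalar_add algebra_simps)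

lemma free_poly_smult: "free_poly (smult c p) = free_scalar c * free_poly p"
  by (induction p)
    (simp_all add: free_poly_pCons free_scalar_mult distrib_left mult.assoc
      free_scalar_left_commute[of free_z])

lemma free_poly_mult: "free_poly (p * q) = free_poly p * free_poly q"
  by (induction p) (simp_all add: free_poly_pCons free_poly_add free_poly_smult distrib_right mult.assoc)

lemma free_poly_linear: "free_poly [:b, c:] = free_scalar b + free_scalar c * free_z"
  by (simp add: free_poly_pCons free_scalar_central[of free_z])

lemma free_action_mult: "free_action (\<lambda>c v. free_scalar c * v) (\<lambda>g v. s g * v)"
  for s :: "gen \<Rightarrow> 'k::field free_alg"
  by unfold_locales
    (simp_all add: distrib_left distrib_right free_scalar_add free_scalar_mult mult.assoc
      free_scalar_left_commute[of "s _"])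

text \<open>
  The algebra endomorphism that sends each generator \<open>g\<close> to \<open>s g\<close>, obtained by letting the
  generators act on the free algebra by left multiplication with their images.
\<close>

definition subst :: "(gen \<Rightarrow> 'k::field free_alg) \<Rightarrow> 'k free_alg \<Rightarrow> 'k free_alg" where
  "subst s f = free_action.act (\<lambda>c v. free_scalar c * v) (\<lambda>g v. s g * v) f 1"

context
  fixes s :: "gen \<Rightarrow> 'k::field free_alg"
begin

interpretation free_action "\<lambda>c v. free_scalar c * v" "\<lambda>g v. s g * v"
  by (rule free_action_mult)

lemma subst_plus: "subst s (f + g) = subst s f + subst s g"
  and subst_diff: "subst s (f - g) = subst s f - subst s g"
  and subst_scalar [simp]: "subst s (free_scalar c) = free_scalar c"
  and subst_gen [simp]: "subst s (free_gen g') = s g'"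
  and subst_one [simp]: "subst s 1 = 1"
  and subst_zero [simp]: "subst s 0 = 0"
  by (simp_all add: subst_def act_plus act_diff)

lemma act_eq_subst: "act f v = subst s f * v"
proof (induction f rule: poly_mapping_induct_single)
  case (add f w c)
  have "word_act w v = word_act w 1 * v"
  proof -
    have "foldr (\<lambda>g v. s g * v) gs v = foldr (\<lambda>g v. s g * v) gs 1 * v" for gs
      by (induction gs) (simp_all add: mult.assoc)
    then show ?thesis by (simp add: word_act_def)
  qed
  with add show ?case
    by (simp add: subst_def act_plus act_single distrib_right mult.assoc)
qed simp

lemma subst_times: "subst s (f * g) = subst s f * subst s g"
  using act_eq_subst[of f "subst s g"] by (simp add: subst_def act_times)

end

lemma free_alg_induct [case_names scalar gen plus times]:
  assumes scalar: "\<And>c. P (free_scalar c)" and gen: "\<And>g. P (free_gen g)"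
    and plus: "\<And>f g. P f \<Longrightarrow> P g \<Longrightarrow> P (f + g)" and times: "\<And>f g. P f \<Longrightarrow> P g \<Longrightarrow> P (f * g)"
  shows "P (f :: 'k::field free_alg)"
proof -
  have word: "P (Poly_Mapping.single (Word gs) 1)" for gs
  proof (induction gs)
    case Nil
    then show ?case using scalar[of 1] by (simp add: free_scalar_def zero_word_def)
  next
    case (Cons g gs)
    then show ?case using times[OF gen[of g] Cons]
      by (simp add: free_gen_def mult_single plus_word_def)
  qed
  have "P (Poly_Mapping.single w c)" for w c
    using times[OF scalar[of c] word[of "letters w"]] by (simp add: free_scalar_def mult_single)
  then show ?thesis
    using scalar[of 0] by (induction f rule: poly_mapping_induct_single) (simp_all add: plus)
qed

lemma subst_free_poly:
  assumes "s GZ = free_poly q"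
  shows "subst s (free_poly d) = free_poly (pcompose d q)"
  by (induction d)
    (simp_all add: assms free_poly_pCons subst_plus subst_times pcompose_pCons free_poly_add free_poly_mult)

section \<open>The skew Laurent representation\<close>

text \<open>
  The function \<open>v\<close> stands for the formal two-sided skew Laurent series
  \<open>\<Sum>\<^sub>i v\<^sub>i t\<^sup>i\<close> with \<open>t d = \<sigma>(d) t\<close>; the operators
  are left multiplication by \<open>t\<close>, by \<open>a t\<^sup>-\<^sup>1\<close> and by \<open>z\<close>.
\<close>

fun laurent_op :: "'k::field poly \<Rightarrow> gen \<Rightarrow> (int \<Rightarrow> 'k poly) \<Rightarrow> int \<Rightarrow> 'k poly" where
  "laurent_op a GX v = (\<lambda>i. shift (v (i - 1)))"
| "laurent_op a GY v = (\<lambda>i. a * unshift (v (i + 1)))"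
| "laurent_op a GZ v = (\<lambda>i. [:0, 1:] * v i)"

lemma shift_add: "shift (p + q) = shift p + shift q"
  and shift_smult: "shift (smult c p) = smult c (shift p)"
  and shift_mult: "shift (p * q) = shift p * shift q"
  by (simp_all add: shift_def pcompose_add pcompose_smult pcompose_mult)

lemma unshift_add: "unshift (p + q) = unshift p + unshift q"
  and unshift_smult: "unshift (smult c p) = smult c (unshift p)"
  and unshift_mult: "unshift (p * q) = unshift p * unshift q"
  by (simp_all add: unshift_def pcompose_add pcompose_smult pcompose_mult)

interpretation laurent: free_action "\<lambda>c v i. smult c (v i)" "laurent_op a" for a :: "'k::field poly"
proof (unfold_locales, goal_cases)
  case (5 g u v)
  then show ?case
    by (cases g) (simp_all add: fun_eq_iff shift_add unshift_add algebra_simps smult_add_right)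
next
  case (6 g c v)
  then show ?case
    by (cases g) (simp_all add: fun_eq_iff shift_smult unshift_smult)
qed (simp_all add: fun_eq_iff smult_add_right smult_add_left)

lemma laurent_free_poly: "laurent.act a (free_poly p) v = (\<lambda>i. p * v i)"
  by (induction p)
    (simp_all add: free_poly_pCons laurent.act_plus laurent.act_times fun_eq_iff)

section \<open>The quotient algebra\<close>

abbreviation free_ring :: "'k::field free_alg ring" where "free_ring \<equiv> ring_of_type_algebra"

lemma free_ring_simps [simp]:
  "carrier free_ring = UNIV" "x \<otimes>\<^bsub>free_ring\<^esub> y = x * y" "x \<oplus>\<^bsub>free_ring\<^esub> y = x + y" "\<one>\<^bsub>free_ring\<^esub> = 1" "\<zero>\<^bsub>free_ring\<^esub> = 0"
  by (simp_all add: ring_of_type_algebra_def)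

lemma ring_free_ring: "ring free_ring"
proof -
  have "\<exists>y. x + y = 0" for x :: "'a free_alg"
    by (rule exI[of _ "- x"]) simp
  then show ?thesis
    by unfold_locales (auto simp: algebra_simps Units_def ring_of_type_algebra_def)
qed

interpretation free_ring: ring "free_ring :: 'k::field free_alg ring"
  by (rule ring_free_ring)

lemma free_ring_minus [simp]: "\<ominus>\<^bsub>free_ring\<^esub> x = - x" "x \<ominus>\<^bsub>free_ring\<^esub> y = x - y"
proof -
  show "\<ominus>\<^bsub>free_ring\<^esub> x = - x" for x :: "'a free_alg"
    using free_ring.minus_equality[of "- x" x] by simp
  then show "x \<ominus>\<^bsub>free_ring\<^esub> y = x - y"
    by (simp add: a_minus_def)
qed

lemma ideal_gwa_ideal: "ideal (gwa_ideal a) free_ring"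
  unfolding gwa_ideal_def by (rule free_ring.genideal_ideal) simp

lemma gwa_ideal_zero [simp]: "0 \<in> gwa_ideal a"
  and gwa_ideal_diff: "f \<in> gwa_ideal a \<Longrightarrow> g \<in> gwa_ideal a \<Longrightarrow> f - g \<in> gwa_ideal a"
  and gwa_ideal_left: "f \<in> gwa_ideal a \<Longrightarrow> h * f \<in> gwa_ideal a"
  and gwa_ideal_right: "f \<in> gwa_ideal a \<Longrightarrow> f * h \<in> gwa_ideal a"
proof -
  interpret ideal "gwa_ideal a" free_ring
    by (rule ideal_gwa_ideal)
  show "0 \<in> gwa_ideal a"
    using zero_closed by simp
  show "f - g \<in> gwa_ideal a" if "f \<in> gwa_ideal a" "g \<in> gwa_ideal a"
    using a_closed[OF that(1) a_inv_closed[OF that(2)]] by simp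
  show "h * f \<in> gwa_ideal a" "f * h \<in> gwa_ideal a" if "f \<in> gwa_ideal a"
    using I_l_closed[OF that, of h] I_r_closed[OF that, of h] by simp_all
qed

lemma relators_in_ideal: "gwa_relators a \<subseteq> gwa_ideal a"
  unfolding gwa_ideal_def by (rule free_ring.genideal_self) simp

text \<open>
  Induction principle for the ideal of relations: closure under differences already yields negatives
  and sums.
\<close>

lemma gwa_ideal_least:
  assumes "gwa_relators a \<subseteq> I" and "0 \<in> I"
    and "\<And>f g. f \<in> I \<Longrightarrow> g \<in> I \<Longrightarrow> f - g \<in> I"
    and "\<And>f g. f \<in> I \<Longrightarrow> g * f \<in> I" and "\<And>f g. f \<in> I \<Longrightarrow> f * g \<in> I"
  shows "gwa_ideal a \<subseteq> I"
proof -
  have um: "- f \<in> I" if "f \<in> I" for f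
    using assms(3)[OF assms(2) that] by simp
  have pl: "f + g \<in> I" if "f \<in> I" "g \<in> I" for f g
    using assms(3)[OF that(1) um[OF that(2)]] by simp
  have "ideal I free_ring"
    by (intro idealI ring_free_ring free_ring.add.subgroupI)
      (use assms um pl in \<open>auto simp: a_inv_def[symmetric]\<close>)
  then show ?thesis
    unfolding gwa_ideal_def using assms(1) by (rule free_ring.genideal_minimal)
qed

lemma gwa_class_eq_iff: "gwa_class a f = gwa_class a g \<longleftrightarrow> f - g \<in> gwa_ideal a"
  unfolding gwa_class_def
  using ring.quotient_eq_iff_same_a_r_cos[OF ring_free_ring ideal_gwa_ideal[of a], of f g] by simp

lemma carrier_gwa: "carrier (gwa a) = range (gwa_class a)"
  by (auto simp: gwa_def FactRing_def A_RCOSETS_def' gwa_class_def)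

lemma gwa_class_in_carrier [simp]: "gwa_class a f \<in> carrier (gwa a)"
  by (simp add: carrier_gwa)

lemma carrier_gwaE:
  assumes "r \<in> carrier (gwa a)"
  obtains f where "r = gwa_class a f"
  using assms by (auto simp: carrier_gwa)

lemma gwa_class_hom: "gwa_class a \<in> ring_hom free_ring (gwa a)"
  unfolding gwa_def gwa_class_def[abs_def] by (rule ideal.rcos_ring_hom[OF ideal_gwa_ideal])

lemma gwa_plus: "gwa_class a f \<oplus>\<^bsub>gwa a\<^esub> gwa_class a g = gwa_class a (f + g)"
  and gwa_times: "gwa_class a f \<otimes>\<^bsub>gwa a\<^esub> gwa_class a g = gwa_class a (f * g)"
  and gwa_one: "\<one>\<^bsub>gwa a\<^esub> = gwa_class a 1"
  using ring_hom_add[OF gwa_class_hom, of f g a] ring_hom_mult[OF gwa_class_hom, of f g a]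
    ring_hom_one[OF gwa_class_hom, of a] by simp_all

text \<open>
  The defining relations hold for \<open>x = t\<close>, \<open>y = a t\<^sup>-\<^sup>1\<close>, so the representation factors through the
  quotient. It serves to prove elements of the quotient distinct.
\<close>

lemma laurent_kills_ideal:
  assumes "f \<in> gwa_ideal a"
  shows "laurent.act a f v = 0"
proof -
  have "gwa_ideal a \<subseteq> {f. \<forall>v. laurent.act a f v = 0}"
  proof (rule gwa_ideal_least)
    show "gwa_relators a \<subseteq> {f. \<forall>v. laurent.act a f v = 0}"
      by (auto simp: gwa_relators_def laurent.act_diff laurent.act_times laurent_free_poly
          shift_mult unshift_mult shift_unshift unshift_shift fun_eq_iff)
  qed (auto simp: laurent.act_diff laurent.act_times laurent.act_vec_zero)
  with assms show ?thesis by auto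
qed

lemma laurent_class_eq:
  assumes "gwa_class a f = gwa_class a g"
  shows "laurent.act a f v i = laurent.act a g v i"
  using laurent_kills_ideal[of "f - g" a v] assms
  by (simp add: gwa_class_eq_iff laurent.act_diff fun_eq_iff)

section \<open>Automorphisms from substitutions\<close>

lemma gwa_alg_autsD:
  assumes "\<phi> \<in> gwa_alg_auts a"
  shows "\<phi> \<in> Bij (carrier (gwa a))" "\<phi> \<in> ring_hom (gwa a) (gwa a)"
    "\<phi> (gwa_class a (free_scalar c)) = gwa_class a (free_scalar c)"
  using assms by (auto simp: gwa_alg_auts_def)

text \<open>
  Values on the generators are given by representatives in the free algebra, so that an automorphism
  can be computed with as a substitution.
\<close>

definition acts_by :: "'k::field poly \<Rightarrow> ('k free_alg set \<Rightarrow> 'k free_alg set) \<Rightarrow> (gen \<Rightarrow> 'k free_alg) \<Rightarrow> bool" where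
  "acts_by a \<phi> s \<longleftrightarrow> (\<forall>g. \<phi> (gwa_class a (free_gen g)) = gwa_class a (s g))"

text \<open>
  An algebra automorphism is determined by the images of the generators because scalars and
  generators generate the free algebra.
\<close>

lemma aut_class:
  assumes \<phi>: "\<phi> \<in> gwa_alg_auts a" and s: "acts_by a \<phi> s"
  shows "\<phi> (gwa_class a f) = gwa_class a (subst s f)"
proof (induction f rule: free_alg_induct)
  case (scalar c)
  then show ?case using gwa_alg_autsD(3)[OF \<phi>] by simp
next
  case (gen g)
  then show ?case using s by (simp add: acts_by_def)
next
  case (plus f g)
  then show ?case
    using ring_hom_add[OF gwa_alg_autsD(2)[OF \<phi>], of "gwa_class a f" "gwa_class a g"]
    by (simp add: gwa_plus subst_plus)
next
  case (times f g)
  then show ?case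
    using ring_hom_mult[OF gwa_alg_autsD(2)[OF \<phi>], of "gwa_class a f" "gwa_class a g"]
    by (simp add: gwa_times subst_times)
qed

lemma aut_eqI:
  assumes "\<phi> \<in> gwa_alg_auts a" "\<psi> \<in> gwa_alg_auts a" "acts_by a \<phi> s" "acts_by a \<psi> s"
  shows "\<phi> = \<psi>"
proof (rule extensionalityI[of _ "carrier (gwa a)"])
  show "\<phi> \<in> extensional (carrier (gwa a))" "\<psi> \<in> extensional (carrier (gwa a))"
    using gwa_alg_autsD(1) assms by (auto simp: Bij_def)
qed (use assms in \<open>auto elim!: carrier_gwaE simp only: aut_class[of \<phi> a s] aut_class[of \<psi> a s]\<close>)

lemma subst_ideal:
  assumes "\<And>r. r \<in> gwa_relators a \<Longrightarrow> subst s r \<in> gwa_ideal a" and "f \<in> gwa_ideal a"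
  shows "subst s f \<in> gwa_ideal a"
proof -
  have "gwa_ideal a \<subseteq> {f. subst s f \<in> gwa_ideal a}"
    using assms(1)
    by (intro gwa_ideal_least)
      (auto simp: subst_diff subst_times intro: gwa_ideal_diff gwa_ideal_left gwa_ideal_right)
  with assms(2) show ?thesis by auto
qed

text \<open>
  A substitution that respects the relations descends to the quotient, and an inverse substitution
  makes the induced map bijective.
\<close>

lemma aut_exists:
  fixes s t :: "gen \<Rightarrow> 'k::field free_alg"
  assumes s: "\<And>r. r \<in> gwa_relators a \<Longrightarrow> subst s r \<in> gwa_ideal a"
    and t: "\<And>r. r \<in> gwa_relators a \<Longrightarrow> subst t r \<in> gwa_ideal a"
    and st: "\<And>g. subst s (t g) = free_gen g" and ts: "\<And>g. subst t (s g) = free_gen g"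
  shows "\<exists>\<phi>\<in>gwa_alg_auts a. acts_by a \<phi> s"
proof -
  let ?C = "carrier (gwa a)"
  \<comment> \<open>The induced map is evaluated on an arbitrary representative; the ideal being mapped into itself
  makes the choice irrelevant.\<close>
  define h where "h u = (\<lambda>r\<in>?C. gwa_class a (subst u (SOME f. r = gwa_class a f)))" for u
  have h: "h u (gwa_class a f) = gwa_class a (subst u f)"
    if u: "\<And>r. r \<in> gwa_relators a \<Longrightarrow> subst u r \<in> gwa_ideal a" for u f
  proof -
    define f' where "f' = (SOME f'. gwa_class a f = gwa_class a f')"
    have "gwa_class a f = gwa_class a f'"
      unfolding f'_def by (rule someI) simp
    then have "gwa_class a (subst u f) = gwa_class a (subst u f')"
      using subst_ideal[OF u, of "f - f'"] by (simp add: gwa_class_eq_iff subst_diff)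
    then show ?thesis
      by (simp add: h_def f'_def)
  qed
  have inv: "subst u (subst w f) = f" if "\<And>g. subst u (w g) = free_gen g"
    for u w :: "gen \<Rightarrow> 'k free_alg" and f
    by (induction f rule: free_alg_induct) (simp_all add: that subst_plus subst_times)
  have "bij_betw (h s) ?C ?C"
    by (rule bij_betw_byWitness[where f' = "h t"])
      (auto elim!: carrier_gwaE simp: h[OF s] h[OF t] inv[OF st] inv[OF ts])
  moreover have "h s \<in> ring_hom (gwa a) (gwa a)"
    by (rule ring_hom_memI)
      (auto elim!: carrier_gwaE simp: h[OF s] gwa_plus gwa_times gwa_one subst_plus subst_times)
  ultimately have "h s \<in> gwa_alg_auts a"
    by (auto simp: gwa_alg_auts_def Bij_def h[OF s]) (simp add: h_def)
  moreover have "acts_by a (h s) s"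
    by (simp add: acts_by_def h[OF s])
  ultimately show ?thesis by blast
qed

lemma aut_compose:
  assumes \<phi>: "\<phi> \<in> gwa_alg_auts a" "acts_by a \<phi> s" and \<psi>: "\<psi> \<in> gwa_alg_auts a" "acts_by a \<psi> t"
  shows "compose (carrier (gwa a)) \<phi> \<psi> \<in> gwa_alg_auts a"
    and "acts_by a (compose (carrier (gwa a)) \<phi> \<psi>) (\<lambda>g. subst s (t g))"
proof -
  let ?C = "carrier (gwa a)"
  have *: "compose ?C \<phi> \<psi> (gwa_class a f) = gwa_class a (subst s (subst t f))" for f
    by (simp add: compose_def aut_class[OF \<phi>] aut_class[OF \<psi>])
  have "compose ?C \<phi> \<psi> \<in> Bij ?C"
    using \<phi> \<psi> by (intro compose_Bij) (auto dest: gwa_alg_autsD)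
  moreover have "compose ?C \<phi> \<psi> \<in> ring_hom (gwa a) (gwa a)"
    by (rule ring_hom_memI)
      (auto elim!: carrier_gwaE simp: * gwa_plus gwa_times gwa_one subst_plus subst_times)
  ultimately show "compose ?C \<phi> \<psi> \<in> gwa_alg_auts a"
    by (simp add: gwa_alg_auts_def *)
  show "acts_by a (compose ?C \<phi> \<psi>) (\<lambda>g. subst s (t g))"
    by (simp add: acts_by_def *)
qed

lemma free_scalar_mult_mult:
  "(free_scalar b * f) * (free_scalar c * g) = free_scalar (b * c) * (f * g)"
  by (metis free_scalar_left_commute free_scalar_mult mult.assoc)

lemma free_poly_X: "free_poly [:0, 1:] = free_z"
  by (simp add: free_poly_linear)

lemma subst_scaled: "subst s (free_scalar c * f) = free_scalar c * subst s f"
  by (simp add: subst_times)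

section \<open>Rescalings and reflections\<close>

fun theta_sub :: "'k::field \<Rightarrow> gen \<Rightarrow> 'k free_alg" where
  "theta_sub \<beta> GX = free_scalar \<beta> * free_x"
| "theta_sub \<beta> GY = free_scalar (inverse \<beta>) * free_y"
| "theta_sub \<beta> GZ = free_z"

text \<open>
  The substitution underlying \<open>\<Theta>\<^sub>\<beta> \<circ> \<Omega>\<close> with \<open>c = \<beta>\<^sup>-\<^sup>1\<close>. The parameter is the coefficient of the
  image of \<open>x\<close>, so that \<open>c = 1\<close> gives \<open>\<Omega>\<close>.
\<close>

fun refl_sub :: "nat \<Rightarrow> 'k::field \<Rightarrow> 'k \<Rightarrow> gen \<Rightarrow> 'k free_alg" where
  "refl_sub n \<rho> c GX = free_scalar c * free_y"
| "refl_sub n \<rho> c GY = free_scalar ((- 1) ^ n * inverse c) * free_x"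
| "refl_sub n \<rho> c GZ = free_scalar (1 + \<rho>) - free_z"

lemma scaled_relator_in_ideal:
  assumes "r \<in> gwa_relators a" "f = free_scalar c * r"
  shows "f \<in> gwa_ideal a"
  using assms relators_in_ideal gwa_ideal_left by blast

text \<open>
  Rescaling multiplies each relator by the product of the scalars of its left-hand factors, which is
  \<open>1\<close> for the relators of \<open>x y\<close> and \<open>y x\<close>.
\<close>

lemma theta_sub_relators:
  assumes "\<beta> \<noteq> 0" and "r \<in> gwa_relators a"
  shows "subst (theta_sub \<beta>) r \<in> gwa_ideal a"
proof -
  have poly: "subst (theta_sub \<beta>) (free_poly d) = free_poly d" for d
    using subst_free_poly[of "theta_sub \<beta>" "[:0, 1:]" d]
    by (simp add: free_poly_X pcompose_idR)
  note simps = subst_diff subst_times poly free_scalar_mult_mult assms(1)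
  from assms(2) consider
      (xy) "r = free_x * free_y - free_poly (shift a)" | (yx) "r = free_y * free_x - free_poly a"
    | (x) d where "r = free_x * free_poly d - free_poly (shift d) * free_x"
    | (y) d where "r = free_y * free_poly d - free_poly (unshift d) * free_y"
    by (auto simp: gwa_relators_def)
  then show ?thesis
  proof cases
    case xy
    then show ?thesis
      by (intro scaled_relator_in_ideal[OF assms(2), of _ 1]) (simp add: simps)
  next
    case yx
    then show ?thesis
      by (intro scaled_relator_in_ideal[OF assms(2), of _ 1]) (simp add: simps)
  next
    case x
    then show ?thesis
      by (intro scaled_relator_in_ideal[OF assms(2), of _ \<beta>])
        (simp add: simps right_diff_distrib mult.assoc free_scalar_left_commute[of "free_poly _"])
  next
    case y
    then show ?thesis
      by (intro scaled_relator_in_ideal[OF assms(2), of _ "inverse \<beta>"])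
        (simp add: simps right_diff_distrib mult.assoc free_scalar_left_commute[of "free_poly _"])
  qed
qed

lemma minus_one_power_square: "(- 1) ^ n * (- 1) ^ n = (1 :: 'a::comm_ring_1)"
  by (simp flip: power_mult_distrib)

text \<open>
  The reflection \<open>q = 1 + \<rho> - z\<close> interchanges \<open>\<sigma>\<close> and \<open>\<sigma>\<^sup>-\<^sup>1\<close>. Reflectivity turns \<open>\<sigma>(a)(q)\<close> into
  \<open>\<plusminus>a\<close> and \<open>a(q)\<close> into \<open>\<plusminus>\<sigma>(a)\<close>, so that relators for \<open>x\<close> become multiples of relators for \<open>y\<close> and
  conversely; the sign \<open>(-1)\<^sup>n\<close> in the image of \<open>y\<close> matches the one in the reflectivity of \<open>a\<close>.
\<close>

lemma refl_sub_relators: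
  assumes refl: "reflective_about a \<rho>" and "c \<noteq> 0" and "r \<in> gwa_relators a"
  shows "subst (refl_sub (degree a) \<rho> c) r \<in> gwa_ideal a"
proof -
  define n where "n = degree a"
  define e :: 'a where "e = (- 1) ^ n"
  define q where "q = [:1 + \<rho>, - 1:]"
  have ee: "e * e = 1"
    by (simp add: e_def minus_one_power_square)
  have z: "refl_sub n \<rho> c GZ = free_poly q"
    by (simp add: q_def free_poly_linear) (simp add: free_scalar_uminus)
  have poly: "subst (refl_sub n \<rho> c) (free_poly d) = free_poly (pcompose d q)" for d
    by (rule subst_free_poly) (rule z)
  have a: "pcompose a [:\<rho>, - 1:] = smult e a"
    using refl by (simp add: reflective_about_def e_def n_def)
  have shift_q: "pcompose (shift d) q = pcompose d [:\<rho>, - 1:]" for d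
    by (simp add: shift_def q_def pcompose_pCons flip: pcompose_assoc)
  have "pcompose a q = shift (pcompose a [:\<rho>, - 1:])"
    by (simp add: shift_def q_def pcompose_pCons algebra_simps flip: pcompose_assoc)
  then have a_q: "pcompose a q = smult e (shift a)"
    by (simp add: a shift_smult)
  have x: "pcompose (shift d) q = unshift (pcompose d q)"
    and y: "pcompose (unshift d) q = shift (pcompose d q)" for d
    by (simp_all add: shift_def unshift_def q_def pcompose_pCons algebra_simps flip: pcompose_assoc)
  have ce: "c * (e * inverse c) = e" "e * inverse c * c = e"
    using assms(2) by (simp_all add: mult.assoc)
  note simps = subst_diff subst_times poly free_scalar_mult_mult free_poly_smult right_diff_distrib
  note simps' = simps mult.assoc free_scalar_left_commute[of "free_poly _"]
  have in_I: "f \<in> gwa_ideal a" if "r' \<in> gwa_relators a" "f = free_scalar b * r'" for f r' b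
    using that by (rule scaled_relator_in_ideal)
  from assms(3) consider
      (xy) "r = free_x * free_y - free_poly (shift a)" | (yx) "r = free_y * free_x - free_poly a"
    | (x) d where "r = free_x * free_poly d - free_poly (shift d) * free_x"
    | (y) d where "r = free_y * free_poly d - free_poly (unshift d) * free_y"
    by (auto simp: gwa_relators_def)
  then have "subst (refl_sub n \<rho> c) r \<in> gwa_ideal a"
  proof cases
    case xy
    then show ?thesis
      by (intro in_I[of "free_y * free_x - free_poly a" _ e])
        (use assms(2) in \<open>simp_all add: gwa_relators_def simps shift_q a ce flip: e_def\<close>)
  next
    case yx
    then show ?thesis
      by (intro in_I[of "free_x * free_y - free_poly (shift a)" _ e])
        (use assms(2) in \<open>simp_all add: gwa_relators_def simps a_q ce flip: e_def\<close>)
  next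
    case (x d)
    then show ?thesis
      by (intro in_I[of "free_y * free_poly (pcompose d q)
              - free_poly (unshift (pcompose d q)) * free_y" _ c])
        (simp_all add: gwa_relators_def simps' \<open>pcompose (shift d) q = unshift (pcompose d q)\<close>)
  next
    case (y d)
    then show ?thesis
      by (intro in_I[of "free_x * free_poly (pcompose d q)
              - free_poly (shift (pcompose d q)) * free_x" _ "e * inverse c"])
        (simp_all add: gwa_relators_def simps' \<open>pcompose (unshift d) q = shift (pcompose d q)\<close> flip: e_def)
  qed
  then show ?thesis by (simp add: n_def)
qed

lemma theta_aut_exists:
  assumes "\<beta> \<noteq> 0"
  shows "\<exists>\<phi>\<in>gwa_alg_auts a. acts_by a \<phi> (theta_sub \<beta>)"
proof (rule aut_exists[of _ _ "theta_sub (inverse \<beta>)"])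
  show "subst (theta_sub \<beta>) (theta_sub (inverse \<beta>) g) = free_gen g" for g
    using assms by (cases g) (simp_all add: subst_scaled flip: mult.assoc free_scalar_mult)
  show "subst (theta_sub (inverse \<beta>)) (theta_sub \<beta> g) = free_gen g" for g
    using assms by (cases g) (simp_all add: subst_scaled flip: mult.assoc free_scalar_mult)
qed (use assms in \<open>auto intro!: theta_sub_relators\<close>)

text \<open>
  Two reflections compose to a rescaling, which is the identity when their parameters differ by the
  factor \<open>(-1)\<^sup>n\<close>; so the inverse is again of this kind.
\<close>

lemma refl_aut_exists:
  assumes "reflective_about a \<rho>" and "c \<noteq> 0"
  shows "\<exists>\<phi>\<in>gwa_alg_auts a. acts_by a \<phi> (refl_sub (degree a) \<rho> c)"
proof -
  let ?n = "degree a"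
  have *: "subst (refl_sub ?n \<rho> b) (refl_sub ?n \<rho> b' g) = free_gen g"
    if "b \<noteq> 0" "b' = (- 1) ^ ?n * b" for b b' g
  proof (cases g)
    case GX
    with that show ?thesis
      by (simp add: subst_scaled flip: mult.assoc free_scalar_mult)
        (simp add: ac_simps minus_one_power_square flip: mult.assoc)
  next
    case GY
    with that show ?thesis
      by (simp add: subst_scaled flip: mult.assoc free_scalar_mult)
  next
    case GZ
    then show ?thesis by (simp add: subst_diff)
  qed
  show ?thesis
  proof (rule aut_exists[of _ _ "refl_sub ?n \<rho> ((- 1) ^ ?n * c)"])
    show "subst (refl_sub ?n \<rho> c) (refl_sub ?n \<rho> ((- 1) ^ ?n * c) g) = free_gen g" for g
      by (rule *) (use assms in auto)
    show "subst (refl_sub ?n \<rho> ((- 1) ^ ?n * c)) (refl_sub ?n \<rho> c g) = free_gen g" for g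
      by (rule *) (use assms in \<open>auto simp: minus_one_power_square simp flip: mult.assoc\<close>)
  qed (use assms in \<open>auto intro!: refl_sub_relators\<close>)
qed

lemma acts_by_iff:
  "acts_by a \<phi> s \<longleftrightarrow> \<phi> (gwa_class a free_x) = gwa_class a (s GX) \<and>
     \<phi> (gwa_class a free_y) = gwa_class a (s GY) \<and> \<phi> (gwa_class a free_z) = gwa_class a (s GZ)"
  unfolding acts_by_def by (metis gen.exhaust)

text \<open>
  Uniqueness comes from the generators, so an existing automorphism with the prescribed values is the
  one that the definite description picks.
\<close>

lemma gwa_aut_with:
  assumes "\<exists>\<phi>\<in>gwa_alg_auts a. acts_by a \<phi> s"
  shows "gwa_aut_with a (s GX) (s GY) (s GZ) \<in> gwa_alg_auts a"
    and "acts_by a (gwa_aut_with a (s GX) (s GY) (s GZ)) s"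
proof -
  from assms have "\<exists>!\<phi>. \<phi> \<in> gwa_alg_auts a \<and> acts_by a \<phi> s"
    using aut_eqI by blast
  from theI'[OF this] show "gwa_aut_with a (s GX) (s GY) (s GZ) \<in> gwa_alg_auts a"
    and "acts_by a (gwa_aut_with a (s GX) (s GY) (s GZ)) s"
    by (simp_all add: gwa_aut_with_def flip: acts_by_iff)
qed

lemma Theta_aut:
  assumes "\<beta> \<noteq> 0"
  shows "Theta a \<beta> \<in> gwa_alg_auts a" and "acts_by a (Theta a \<beta>) (theta_sub \<beta>)"
  using gwa_aut_with[OF theta_aut_exists[OF assms]] by (simp_all add: Theta_def)

lemma Omega_aut:
  assumes "reflective_about a \<rho>"
  shows "Omega a \<rho> \<in> gwa_alg_auts a" and "acts_by a (Omega a \<rho>) (refl_sub (degree a) \<rho> 1)"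
  using gwa_aut_with[OF refl_aut_exists[OF assms, of 1]] by (simp_all add: Omega_def)

lemma Theta_Omega_aut:
  assumes "reflective_about a \<rho>" and "\<beta> \<noteq> 0"
  shows "Theta_Omega a \<rho> \<beta> \<in> gwa_alg_auts a"
    and "acts_by a (Theta_Omega a \<rho> \<beta>) (refl_sub (degree a) \<rho> (inverse \<beta>))"
proof -
  have "(\<lambda>g. subst (theta_sub \<beta>) (refl_sub (degree a) \<rho> 1 g)) = refl_sub (degree a) \<rho> (inverse \<beta>)"
  proof
    fix g
    show "subst (theta_sub \<beta>) (refl_sub (degree a) \<rho> 1 g) = refl_sub (degree a) \<rho> (inverse \<beta>) g"
      by (cases g) (simp_all add: subst_scaled subst_diff free_scalar_mult mult.assoc)
  qed
  then show "Theta_Omega a \<rho> \<beta> \<in> gwa_alg_auts a"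
    and "acts_by a (Theta_Omega a \<rho> \<beta>) (refl_sub (degree a) \<rho> (inverse \<beta>))"
    using aut_compose[OF Theta_aut[OF assms(2)] Omega_aut[OF assms(1)]]
    by (simp_all add: Theta_Omega_def)
qed

text \<open>
  Products in the automorphism group reduce to an identity of substitutions on the three generators.
\<close>

lemma gwa_alg_auts_mult:
  assumes "\<phi> \<in> gwa_alg_auts a" "\<psi> \<in> gwa_alg_auts a" "\<chi> \<in> gwa_alg_auts a"
    and "acts_by a \<phi> s" "acts_by a \<psi> t" "acts_by a \<chi> u"
    and "\<And>g. subst s (t g) = u g"
  shows "\<phi> \<otimes>\<^bsub>filtered_Aut a\<^esub> \<psi> = \<chi>"
proof -
  have "\<phi> \<otimes>\<^bsub>filtered_Aut a\<^esub> \<psi> = compose (carrier (gwa a)) \<phi> \<psi>"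
    using assms(1,2) by (simp add: filtered_Aut_def BijGroup_def gwa_alg_autsD)
  also have "\<dots> = \<chi>"
    using aut_compose[OF assms(1,4) assms(2,5)] assms(3,6,7) by (intro aut_eqI) simp_all
  finally show ?thesis .
qed

lemma Theta_mult_Theta:
  assumes "\<beta> \<noteq> 0" "\<gamma> \<noteq> 0"
  shows "Theta a \<beta> \<otimes>\<^bsub>filtered_Aut a\<^esub> Theta a \<gamma> = Theta a (\<beta> * \<gamma>)"
proof (rule gwa_alg_auts_mult)
  show "subst (theta_sub \<beta>) (theta_sub \<gamma> g) = theta_sub (\<beta> * \<gamma>) g" for g
    by (cases g) (simp_all add: subst_scaled ac_simps flip: mult.assoc free_scalar_mult)
qed (use assms in \<open>auto intro!: Theta_aut\<close>)

lemma Theta_mult_Theta_Omega: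
  assumes "reflective_about a \<rho>" "\<beta> \<noteq> 0" "\<gamma> \<noteq> 0"
  shows "Theta a \<beta> \<otimes>\<^bsub>filtered_Aut a\<^esub> Theta_Omega a \<rho> \<gamma> = Theta_Omega a \<rho> (\<beta> * \<gamma>)"
proof (rule gwa_alg_auts_mult)
  show "subst (theta_sub \<beta>) (refl_sub (degree a) \<rho> (inverse \<gamma>) g)
      = refl_sub (degree a) \<rho> (inverse (\<beta> * \<gamma>)) g" for g
    by (cases g) (simp_all add: subst_scaled subst_diff ac_simps flip: mult.assoc free_scalar_mult)
qed (use assms in \<open>auto intro!: Theta_aut Theta_Omega_aut simp del: inverse_mult_distrib inverse_divide\<close>)

lemma Theta_Omega_mult_Theta:
  assumes "reflective_about a \<rho>" "\<beta> \<noteq> 0" "\<gamma> \<noteq> 0"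
  shows "Theta_Omega a \<rho> \<beta> \<otimes>\<^bsub>filtered_Aut a\<^esub> Theta a \<gamma> = Theta_Omega a \<rho> (\<beta> / \<gamma>)"
proof (rule gwa_alg_auts_mult)
  show "subst (refl_sub (degree a) \<rho> (inverse \<beta>)) (theta_sub \<gamma> g)
      = refl_sub (degree a) \<rho> (inverse (\<beta> / \<gamma>)) g" for g
    by (cases g)
      (simp_all add: subst_scaled subst_diff field_simps flip: mult.assoc free_scalar_mult)
qed (use assms in \<open>auto intro!: Theta_aut Theta_Omega_aut simp del: inverse_mult_distrib inverse_divide\<close>)

lemma Theta_Omega_mult_Theta_Omega:
  assumes "reflective_about a \<rho>" "\<beta> \<noteq> 0" "\<gamma> \<noteq> 0"
  shows "Theta_Omega a \<rho> \<beta> \<otimes>\<^bsub>filtered_Aut a\<^esub> Theta_Omega a \<rho> \<gamma>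
    = Theta a ((- 1) ^ degree a * \<beta> / \<gamma>)"
proof (rule gwa_alg_auts_mult)
  show "subst (refl_sub (degree a) \<rho> (inverse \<beta>)) (refl_sub (degree a) \<rho> (inverse \<gamma>) g)
      = theta_sub ((- 1) ^ degree a * \<beta> / \<gamma>) g" for g
    by (cases g; cases "even (degree a)")
      (simp_all add: subst_scaled subst_diff field_simps flip: mult.assoc free_scalar_mult)
qed (use assms in \<open>auto intro!: Theta_aut Theta_Omega_aut simp del: inverse_mult_distrib inverse_divide\<close>)

section \<open>Classification of the filtered automorphisms\<close>

lemma filtered_AutD:
  assumes "\<phi> \<in> carrier (filtered_Aut a)"
  shows "\<phi> \<in> gwa_alg_auts a" and "r \<in> carrier (gwa a) \<Longrightarrow> gwa_deg a (\<phi> r) = gwa_deg a r"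
  using assms by (auto simp: filtered_Aut_def)

text \<open>
  Every element has a representative with finitely many words and so lies in some step of the
  filtration; hence its degree is attained, and preserving the degree means preserving each step.
\<close>

lemma filtered_Aut_filtration:
  assumes \<phi>: "\<phi> \<in> carrier (filtered_Aut a)" and r: "r \<in> gwa_filtration a i"
  shows "\<phi> r \<in> gwa_filtration a i"
proof -
  have carr: "r \<in> carrier (gwa a)"
    using r by (auto simp: gwa_filtration_def)
  then have "\<phi> r \<in> carrier (gwa a)"
    using gwa_alg_autsD(1)[OF filtered_AutD(1)[OF \<phi>]] by (auto simp: Bij_def bij_betw_def)
  then obtain f where f: "\<phi> r = gwa_class a f"
    by (rule carrier_gwaE)
  \<comment> \<open>The sum of the weights of all words of a representative is a crude common bound for them.\<close>
  have "\<phi> r \<in> gwa_filtration a (\<Sum>w\<in>Poly_Mapping.keys f. word_weight (degree a) w)"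
    unfolding f gwa_filtration_def by (auto intro!: imageI member_le_sum)
  then have "\<phi> r \<in> gwa_filtration a (gwa_deg a (\<phi> r))"
    unfolding gwa_deg_def by (rule LeastI)
  moreover have "gwa_deg a (\<phi> r) \<le> i"
    using filtered_AutD(2)[OF \<phi> carr] r by (simp add: gwa_deg_def Least_le)
  ultimately show ?thesis
    unfolding gwa_filtration_def by force
qed

lemma filtered_Aut_representative:
  assumes "\<phi> \<in> carrier (filtered_Aut a)" and "\<forall>w\<in>Poly_Mapping.keys f. word_weight (degree a) w \<le> i"
  obtains g where "\<phi> (gwa_class a f) = gwa_class a g"
    "\<forall>w\<in>Poly_Mapping.keys g. word_weight (degree a) w \<le> i"
  using filtered_Aut_filtration[OF assms(1), of "gwa_class a f" i] assms(2)
  by (auto simp: gwa_filtration_def)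

text \<open>
  One letter \<open>x\<close> or \<open>y\<close> already uses up the weight \<open>n\<close>, so that no further letter fits.
\<close>

lemma light_word:
  assumes "word_weight n w \<le> n" and "n > 0"
  shows "(\<exists>k. letters w = replicate k GZ \<and> word_weight n w = 2 * k)
    \<or> letters w = [GX] \<or> letters w = [GY]"
proof -
  have "(\<exists>k. gs = replicate k GZ \<and> (\<Sum>g\<leftarrow>gs. gen_weight n g) = 2 * k) \<or> gs = [GX] \<or> gs = [GY]"
    if "(\<Sum>g\<leftarrow>gs. gen_weight n g) \<le> n" for gs
    using that
  proof (induction gs)
    case (Cons g gs)
    have pos: "gs = []" if "(\<Sum>g\<leftarrow>gs. gen_weight n g) = 0"
    proof (cases gs)
      case (Cons h hs)
      then show ?thesis using that \<open>n > 0\<close> by (cases h) auto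
    qed
    show ?case
    proof (cases g)
      case GZ
      with Cons obtain k where "gs = replicate k GZ" "(\<Sum>g\<leftarrow>gs. gen_weight n g) = 2 * k"
        by auto
      with GZ show ?thesis
        by (intro disjI1 exI[of _ "Suc k"]) simp
    qed (use Cons.prems pos in auto)
  qed (use exI[of "\<lambda>k. [] = replicate k GZ \<and> 0 = 2 * k" 0] in auto)
  with assms(1) show ?thesis by (simp add: word_weight_def)
qed

lemma single_replicate_z: "Poly_Mapping.single (Word (replicate k GZ)) c = free_poly (monom c k)"
proof (induction k)
  case 0
  then show ?case by (simp add: monom_0 free_poly_pCons free_scalar_def zero_word_def)
next
  case (Suc k)
  have "free_poly (monom c (Suc k)) = free_z * free_poly (monom c k)"
    by (simp add: monom_Suc free_poly_pCons)
  also have "\<dots> = Poly_Mapping.single (Word (replicate (Suc k) GZ)) c"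
    by (simp add: free_gen_def mult_single plus_word_def flip: Suc)
  finally show ?case ..
qed

lemma light_element:
  fixes f :: "'k::field free_alg"
  assumes "\<forall>w\<in>Poly_Mapping.keys f. word_weight n w \<le> n" and "n > 0"
  shows "\<exists>p b c. f = free_poly p + free_scalar b * free_x + free_scalar c * free_y"
proof (induction f rule: poly_mapping_induct_keys)
  case 1
  show ?case by (intro exI[of _ 0]) simp
next
  case (2 g w d)
  then obtain p b c where g: "g = free_poly p + free_scalar b * free_x + free_scalar c * free_y"
    by blast
  have w: "Poly_Mapping.single w d = Poly_Mapping.single (Word (letters w)) d"
    by simp
  have x: "Poly_Mapping.single (Word [GX]) d = free_scalar d * free_x"
    and y: "Poly_Mapping.single (Word [GY]) d = free_scalar d * free_y"
    by (simp_all add: free_scalar_def free_gen_def mult_single plus_word_def zero_word_def)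
  consider k where "letters w = replicate k GZ" | "letters w = [GX]" | "letters w = [GY]"
    using light_word[of n w] assms 2(1) by blast
  then show ?case
  proof cases
    case 1
    then show ?thesis
      by (intro exI[of _ "monom d k + p"] exI[of _ b] exI[of _ c])
        (simp only: w single_replicate_z g free_poly_add add.assoc)
  next
    case 2
    then show ?thesis
      by (intro exI[of _ p] exI[of _ "d + b"] exI[of _ c])
        (simp only: w x g free_scalar_add distrib_right ac_simps)
  next
    case 3
    then show ?thesis
      by (intro exI[of _ p] exI[of _ b] exI[of _ "d + c"])
        (simp only: w y g free_scalar_add distrib_right ac_simps)
  qed
qed

lemma very_light_element:
  fixes f :: "'k::field free_alg"
  assumes "\<forall>w\<in>Poly_Mapping.keys f. word_weight n w \<le> 2" and "n \<ge> 3"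
  shows "\<exists>\<gamma> \<alpha>. f = free_poly [:\<gamma>, \<alpha>:]"
proof (induction f rule: poly_mapping_induct_keys)
  case 1
  show ?case by (intro exI[of _ 0]) simp
next
  case (2 g w d)
  then obtain \<gamma> \<alpha> where g: "g = free_poly [:\<gamma>, \<alpha>:]"
    by blast
  have le: "word_weight n w \<le> 2"
    using 2(1) assms(1) by blast
  then have "letters w \<noteq> [GX]" "letters w \<noteq> [GY]"
    using assms(2) by (auto simp: word_weight_def)
  then obtain k where k: "letters w = replicate k GZ" "2 * k \<le> 2"
    using light_word[of n w] le assms(2) by auto
  have w: "Poly_Mapping.single w d = free_poly (monom d k)"
    using single_replicate_z[of k d] k(1) by (metis word.collapse)
  from k(2) consider "k = 0" | "k = 1" by linarith
  then show ?case
  proof cases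
    case 1
    then show ?thesis
      by (intro exI[of _ "d + \<gamma>"] exI[of _ \<alpha>]) (simp add: w g monom_0 flip: free_poly_add)
  next
    case 2
    then show ?thesis
      by (intro exI[of _ \<gamma>] exI[of _ "d + \<alpha>"])
        (simp add: w g monom_Suc monom_0 flip: free_poly_add)
  qed
qed

text \<open>
  The root \<open>0\<close> would be translated to the infinitely many roots \<open>t, 2t, 3t, \<dots>\<close>.
\<close>

lemma translation_invariant_poly:
  fixes a :: "'k::{idom, ring_char_0} poly"
  assumes "pcompose a [:t, 1:] = a" and "poly a 0 = 0" and "a \<noteq> 0"
  shows "t = 0"
proof (rule ccontr)
  assume "t \<noteq> 0"
  have "poly a (of_nat k * t) = 0" for k
  proof (induction k)
    case (Suc k)
    have "poly a (of_nat (Suc k) * t) = poly (pcompose a [:t, 1:]) (of_nat k * t)"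
      by (simp add: poly_pcompose algebra_simps)
    then show ?case using Suc assms(1) by simp
  qed (use assms in simp)
  then have "range (\<lambda>k. of_nat k * t) \<subseteq> {x. poly a x = 0}"
    by auto
  moreover have "infinite (range (\<lambda>k. of_nat k * t))"
    using \<open>t \<noteq> 0\<close> by (intro range_inj_infinite injI) auto
  ultimately show False
    using poly_roots_finite[OF assms(3)] finite_subset by blast
qed

text \<open>
  The unit \<open>1 = t\<^sup>0\<close> of the skew Laurent ring, on which the representation is evaluated.
\<close>

definition delta :: "int \<Rightarrow> 'k::field poly" where
  "delta i = (if i = 0 then 1 else 0)"

lemma shift_simps [simp]: "shift 0 = 0" "shift 1 = 1" "shift [:c:] = [:c:]" "shift [:c, d:] = [:c - d, d:]"
  and unshift_simps [simp]: "unshift 0 = 0" "unshift 1 = 1" "unshift [:c:] = [:c:]" "unshift [:c, d:] = [:c + d, d:]"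
  by (simp_all add: shift_def unshift_def pcompose_pCons pcompose_1)

text \<open>
  In the skew Laurent ring the element is \<open>u = p + b t + c a t\<^sup>-\<^sup>1\<close>, and the hypothesis reads
  \<open>u (\<gamma> + \<alpha> z) = (\<gamma> + e + \<alpha> z) u\<close>. Moving \<open>t\<^sup>j\<close> past \<open>z\<close> replaces \<open>\<gamma> + \<alpha> z\<close> by
  \<open>\<gamma> - j \<alpha> + \<alpha> z\<close>, so a nonzero component in degree \<open>j\<close> forces \<open>- j \<alpha> = e\<close>.
\<close>

lemma z_eigenvector:
  assumes "gwa_class a ((free_poly p + free_scalar b * free_x + free_scalar c * free_y) * free_poly [:\<gamma>, \<alpha>:])
    = gwa_class a (free_poly [:\<gamma> + e, \<alpha>:] * (free_poly p + free_scalar b * free_x + free_scalar c * free_y))"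
    and "e \<noteq> 0" and "a \<noteq> 0"
  shows "p = 0" and "b = 0 \<or> \<alpha> = - e" and "c = 0 \<or> \<alpha> = e"
proof -
  note simps = laurent.act_plus laurent.act_times laurent_free_poly delta_def
  have "p * [:\<gamma>, \<alpha>:] = [:\<gamma> + e, \<alpha>:] * p"
    using laurent_class_eq[OF assms(1), of delta 0] by (simp add: simps)
  then have "smult e p = 0"
    by (simp add: algebra_simps smult_add_left)
  then show "p = 0"
    using assms(2) by simp
  have "smult b [:\<gamma> - \<alpha>, \<alpha>:] = [:\<gamma> + e, \<alpha>:] * [:b:]"
    using laurent_class_eq[OF assms(1), of delta 1] by (simp add: simps \<open>p = 0\<close>)
  then have "b * (\<alpha> + e) = 0"
    by (simp add: algebra_simps)
  then show "b = 0 \<or> \<alpha> = - e"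
    by (simp add: eq_neg_iff_add_eq_0)
  have "smult (c * (\<alpha> - e)) a = 0"
    using laurent_class_eq[OF assms(1), of delta "-1"]
    by (simp add: simps \<open>p = 0\<close> algebra_simps smult_add_left smult_add_right smult_diff_left)
  then show "c = 0 \<or> \<alpha> = e"
    using assms(3) by simp
qed

lemma gwa_relation:
  "gwa_class a (free_y * free_x) = gwa_class a (free_poly a)"
  "gwa_class a (free_x * free_z) = gwa_class a (free_poly [:- 1, 1:] * free_x)"
  "gwa_class a (free_y * free_z) = gwa_class a (free_poly [:1, 1:] * free_y)"
proof -
  show "gwa_class a (free_y * free_x) = gwa_class a (free_poly a)"
    using relators_in_ideal[of a] by (auto simp: gwa_class_eq_iff gwa_relators_def)
  have "free_x * free_poly [:0, 1:] - free_poly (shift [:0, 1:]) * free_x \<in> gwa_relators a"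
    "free_y * free_poly [:0, 1:] - free_poly (unshift [:0, 1:]) * free_y \<in> gwa_relators a"
    unfolding gwa_relators_def by blast+
  then show "gwa_class a (free_x * free_z) = gwa_class a (free_poly [:- 1, 1:] * free_x)"
    "gwa_class a (free_y * free_z) = gwa_class a (free_poly [:1, 1:] * free_y)"
    using relators_in_ideal[of a] by (auto simp: gwa_class_eq_iff free_poly_X)
qed

text \<open>
  The images of the generators have few coefficients by degree reasons. The relations with \<open>z\<close> have
  \<open>e = -1\<close> for \<open>x\<close> and \<open>e = 1\<close> for \<open>y\<close> in \<open>z_eigenvector\<close>, which kills all but one coefficient of each
  image (injectivity excludes \<open>\<phi> x = 0\<close>), and the relation \<open>y x = a\<close> fixes the rest.
\<close>

theorem filtered_Aut_cases:
  fixes a :: "'k::field_char_0 poly"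
  assumes lead: "lead_coeff a = 1" and deg: "degree a \<ge> 3" and root: "poly a 0 = 0"
    and reflective: "reflective_about a \<rho>" and \<phi>: "\<phi> \<in> carrier (filtered_Aut a)"
  obtains \<beta> where "\<beta> \<noteq> 0" "\<phi> = Theta a \<beta>"
  | \<beta> where "\<beta> \<noteq> 0" "\<phi> = Theta_Omega a \<rho> \<beta>"
proof -
  let ?n = "degree a"
  note aut = filtered_AutD(1)[OF \<phi>]
  have a0: "a \<noteq> 0"
    using lead by auto
  have light: "\<exists>p b c. \<phi> (gwa_class a (free_gen g))
      = gwa_class a (free_poly p + free_scalar b * free_x + free_scalar c * free_y)"
    if "g = GX \<or> g = GY" for g
  proof -
    have "\<forall>w\<in>Poly_Mapping.keys (free_gen g :: 'k free_alg). word_weight ?n w \<le> ?n"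
      using that by (auto simp: free_gen_def word_weight_def)
    then obtain f where f: "\<phi> (gwa_class a (free_gen g)) = gwa_class a f"
      "\<forall>w\<in>Poly_Mapping.keys f. word_weight ?n w \<le> ?n"
      by (rule filtered_Aut_representative[OF \<phi>])
    from light_element[OF f(2)] deg f(1) show ?thesis
      by auto
  qed
  obtain p b c where x: "\<phi> (gwa_class a free_x)
      = gwa_class a (free_poly p + free_scalar b * free_x + free_scalar c * free_y)"
    using light[of GX] by auto
  obtain p' b' c' where y: "\<phi> (gwa_class a free_y)
      = gwa_class a (free_poly p' + free_scalar b' * free_x + free_scalar c' * free_y)"
    using light[of GY] by auto
  have "\<forall>w\<in>Poly_Mapping.keys (free_z :: 'k free_alg). word_weight ?n w \<le> 2"
    by (auto simp: free_gen_def word_weight_def)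
  then obtain f where f: "\<phi> (gwa_class a free_z) = gwa_class a f"
    "\<forall>w\<in>Poly_Mapping.keys f. word_weight ?n w \<le> 2"
    by (rule filtered_Aut_representative[OF \<phi>])
  from very_light_element[OF f(2) deg] f(1)
  obtain \<gamma> \<alpha> where z: "\<phi> (gwa_class a free_z) = gwa_class a (free_poly [:\<gamma>, \<alpha>:])"
    by auto
  define s where "s = case_gen (free_poly p + free_scalar b * free_x + free_scalar c * free_y)
    (free_poly p' + free_scalar b' * free_x + free_scalar c' * free_y) (free_poly [:\<gamma>, \<alpha>:])"
  have s: "acts_by a \<phi> s"
    by (simp add: acts_by_iff s_def x y z)
  have poly: "subst s (free_poly d) = free_poly (pcompose d [:\<gamma>, \<alpha>:])" for d
    by (rule subst_free_poly) (simp add: s_def)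
  have rel: "gwa_class a (subst s f) = gwa_class a (subst s g)" if "gwa_class a f = gwa_class a g" for f g
    using that by (simp flip: aut_class[OF aut s])
  have xz: "p = 0" "b = 0 \<or> \<alpha> = 1" "c = 0 \<or> \<alpha> = - 1"
    using z_eigenvector[of a p b c \<gamma> \<alpha> "- 1"] rel[OF gwa_relation(2)] a0
    by (simp_all add: subst_times poly) (simp_all add: s_def pcompose_pCons)
  have yz: "p' = 0" "b' = 0 \<or> \<alpha> = - 1" "c' = 0 \<or> \<alpha> = 1"
    using z_eigenvector[of a p' b' c' \<gamma> \<alpha> 1] rel[OF gwa_relation(3)] a0
    by (simp_all add: subst_times poly) (simp_all add: s_def pcompose_pCons add.commute)
  have yx: "laurent.act a (s GY * s GX) delta 0 = pcompose a [:\<gamma>, \<alpha>:]"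
    using laurent_class_eq[OF rel[OF gwa_relation(1)], of delta 0]
    by (simp add: subst_times poly laurent_free_poly delta_def)
  note simps = laurent.act_plus laurent.act_times laurent_free_poly delta_def
  consider (id) "\<alpha> = 1" | (flip) "\<alpha> = - 1" | (zero) "b = 0" "c = 0"
    using xz by blast
  then show ?thesis
  proof cases
    case id
    then have "c = 0" "b' = 0"
      using xz yz by auto
    with yx id xz yz have *: "smult (c' * b) a = pcompose a [:\<gamma>, 1:]"
      by (simp add: s_def simps mult.commute)
    \<comment> \<open>Leading coefficients give the product of the two scalars, and the translation symmetry of \<open>a\<close>
    that remains gives \<open>\<gamma> = 0\<close>.\<close>
    have "lead_coeff (pcompose a [:\<gamma>, 1:]) = 1"
      using lead by (subst lead_coeff_comp) auto
    with * lead have cb: "c' * b = 1"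
      by (metis lead_coeff_smult mult.right_neutral)
    with * have "\<gamma> = 0"
      using translation_invariant_poly[of a \<gamma>] root a0 by simp
    have b: "b \<noteq> 0" "c' = inverse b"
      using cb inverse_unique[of b c'] by (auto simp: mult.commute)
    have "acts_by a \<phi> (theta_sub b)"
      by (simp add: acts_by_iff x y z xz yz \<open>c = 0\<close> \<open>b' = 0\<close> \<open>\<gamma> = 0\<close> id b free_poly_X)
    then have "\<phi> = Theta a b"
      using aut Theta_aut[OF b(1)] aut_eqI by blast
    with b(1) show ?thesis
      using that(1) by blast
  next
    case flip
    then have "b = 0" "c' = 0"
      using xz yz by (auto simp: eq_neg_iff_add_eq_0)
    with yx flip xz yz have *: "smult (b' * c) (shift a) = pcompose a [:\<gamma>, - 1:]"
      by (simp add: s_def simps mult.commute shift_smult)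
    have "lead_coeff (pcompose a [:\<gamma>, - 1:]) = (- 1) ^ ?n" "lead_coeff (shift a) = 1"
      unfolding shift_def using lead by (subst lead_coeff_comp; simp)+
    with * have bc: "b' * c = (- 1) ^ ?n"
      by (metis lead_coeff_smult mult.right_neutral)
    have "pcompose a [:1 + \<rho>, - 1:] = shift (pcompose a [:\<rho>, - 1:])"
      by (simp add: shift_def pcompose_pCons algebra_simps flip: pcompose_assoc)
    also have "\<dots> = pcompose a [:\<gamma>, - 1:]"
      using reflective by (simp add: reflective_about_def shift_smult bc flip: *)
    \<comment> \<open>Two reflections act in the same way on \<open>a\<close>, so \<open>a\<close> is invariant under their composite, which is
    a translation.\<close>
    finally have "pcompose (pcompose a [:1 + \<rho>, - 1:]) [:1 + \<rho>, - 1:]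
        = pcompose (pcompose a [:\<gamma>, - 1:]) [:1 + \<rho>, - 1:]"
      by simp
    then have "pcompose a [:\<gamma> - (1 + \<rho>), 1:] = a"
      by (simp add: pcompose_pCons pcompose_idR algebra_simps flip: pcompose_assoc)
    then have \<gamma>: "\<gamma> = 1 + \<rho>"
      using translation_invariant_poly[of a "\<gamma> - (1 + \<rho>)"] root a0 by simp
    have c: "c \<noteq> 0"
      using bc by auto
    then have b': "b' = (- 1) ^ ?n * inverse c"
      using bc by (simp add: field_simps)
    have "acts_by a \<phi> (refl_sub ?n \<rho> c)"
      by (simp add: acts_by_iff x y z xz yz \<open>b = 0\<close> \<open>c' = 0\<close> \<gamma> flip b' free_poly_linear free_scalar_uminus)
    then have "\<phi> = Theta_Omega a \<rho> (inverse c)"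
      using aut Theta_Omega_aut[OF reflective, of "inverse c"] aut_eqI c by force
    with c show ?thesis
      using that(2)[of "inverse c"] by simp
  next
    case zero
    have "\<phi> (gwa_class a free_x) = \<phi> (gwa_class a 0)"
      by (simp add: x xz zero aut_class[OF aut s, of 0])
    moreover have "inj_on \<phi> (carrier (gwa a))"
      using gwa_alg_autsD(1)[OF aut] by (auto simp: Bij_def bij_betw_def)
    ultimately have "gwa_class a free_x = gwa_class a 0"
      by (simp add: inj_on_eq_iff)
    from laurent_class_eq[OF this, of delta 1] have False
      by (simp add: simps)
    then show ?thesis ..
  qed
qed

lemma Theta_inj:
  assumes "Theta a \<beta> = Theta a \<gamma>" "\<beta> \<noteq> 0" "\<gamma> \<noteq> 0"
  shows "\<beta> = \<gamma>"
proof -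
  have "gwa_class a (free_scalar \<beta> * free_x) = gwa_class a (free_scalar \<gamma> * free_x)"
    using Theta_aut(2)[of \<beta> a] Theta_aut(2)[of \<gamma> a] assms by (simp add: acts_by_iff)
  from laurent_class_eq[OF this, of delta 1] show ?thesis
    by (simp add: laurent.act_times delta_def)
qed

lemma Theta_Omega_inj:
  assumes "reflective_about a \<rho>" "a \<noteq> 0"
    and "Theta_Omega a \<rho> \<beta> = Theta_Omega a \<rho> \<gamma>" "\<beta> \<noteq> 0" "\<gamma> \<noteq> 0"
  shows "\<beta> = \<gamma>"
proof -
  have "gwa_class a (free_scalar (inverse \<beta>) * free_y) = gwa_class a (free_scalar (inverse \<gamma>) * free_y)"
    using Theta_Omega_aut(2)[OF assms(1), of \<beta>] Theta_Omega_aut(2)[OF assms(1), of \<gamma>] assms(3-5)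
    by (simp add: acts_by_iff)
  from laurent_class_eq[OF this, of delta "- 1"] have "smult (inverse \<beta> - inverse \<gamma>) a = 0"
    by (simp add: laurent.act_times delta_def smult_diff_left)
  with assms(2) show ?thesis
    by simp
qed

lemma Theta_neq_Theta_Omega:
  assumes "reflective_about a \<rho>" "\<beta> \<noteq> 0" "\<gamma> \<noteq> 0"
  shows "Theta a \<beta> \<noteq> Theta_Omega a \<rho> \<gamma>"
proof
  assume "Theta a \<beta> = Theta_Omega a \<rho> \<gamma>"
  then have "gwa_class a (free_scalar \<beta> * free_x) = gwa_class a (free_scalar (inverse \<gamma>) * free_y)"
    using Theta_aut(2)[OF assms(2), of a] Theta_Omega_aut(2)[OF assms(1,3)]
    by (simp add: acts_by_iff)
  from laurent_class_eq[OF this, of delta 1] show False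
    using assms(2) by (simp add: laurent.act_times delta_def)
qed

section \<open>Finite multiplicative groups in a field\<close>

text \<open>
  The multiplicative order, as a relation that entails that it is finite.
\<close>

definition is_ord :: "'a::monoid_mult \<Rightarrow> nat \<Rightarrow> bool" where
  "is_ord x n \<longleftrightarrow> n > 0 \<and> (\<forall>k. x ^ k = 1 \<longleftrightarrow> n dvd k)"

lemma is_ord_exists:
  assumes "x ^ k = 1" and "k > 0"
  shows "\<exists>n. is_ord x n"
proof -
  define n where "n = (LEAST n. n > 0 \<and> x ^ n = 1)"
  have n: "n > 0 \<and> x ^ n = 1"
    unfolding n_def by (rule LeastI[of _ k]) (use assms in simp)
  have "n dvd j" if "x ^ j = 1" for j
  proof (rule ccontr)
    assume "\<not> n dvd j"
    then have "j mod n > 0"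
      by (simp add: dvd_eq_mod_eq_0)
    have "x ^ j = x ^ (n * (j div n) + j mod n)"
      by simp
    also have "\<dots> = x ^ (j mod n)"
      using n by (simp only: power_add power_mult) simp
    finally have "j mod n > 0 \<and> x ^ (j mod n) = 1"
      using that \<open>j mod n > 0\<close> by simp
    then have "n \<le> j mod n"
      unfolding n_def by (rule Least_le)
    then show False
      using mod_less_divisor[of n j] n by linarith
  qed
  moreover have "x ^ j = 1" if "n dvd j" for j
    using that n by (auto simp: power_mult)
  ultimately show ?thesis
    using n by (auto simp: is_ord_def)
qed

lemma is_ord_power:
  assumes "is_ord x (d * n)"
  shows "is_ord (x ^ d) n"
  using assms by (auto simp: is_ord_def simp flip: power_mult)

text \<open>
  Raising \<open>(x y)\<^sup>k = 1\<close> to the power \<open>n\<close> removes \<open>y\<close> and shows that \<open>m\<close> divides \<open>k n\<close>, hence \<open>k\<close>;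
  the same holds with the roles exchanged.
\<close>

lemma is_ord_mult:
  fixes x y :: "'a::comm_monoid_mult"
  assumes x: "is_ord x m" and y: "is_ord y n" and "coprime m n"
  shows "is_ord (x * y) (m * n)"
proof -
  have "m * n dvd k" if "(x * y) ^ k = 1" for k
  proof -
    have "x ^ (k * n) * y ^ (k * n) = 1" "x ^ (k * m) * y ^ (k * m) = 1"
      using that by (simp_all add: power_mult flip: power_mult_distrib)
    moreover have "y ^ (k * n) = 1" "x ^ (k * m) = 1"
      using x y by (simp_all add: is_ord_def)
    ultimately have "m dvd k * n" "n dvd k * m"
      using x y by (simp_all add: is_ord_def)
    then have "m dvd k" "n dvd k"
      using \<open>coprime m n\<close> by (simp_all add: coprime_dvd_mult_left_iff coprime_commute)
    then show ?thesis
      using \<open>coprime m n\<close> by (simp add: divides_mult)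
  qed
  moreover have "(x * y) ^ k = 1" if "m * n dvd k" for k
  proof -
    have "m dvd k" "n dvd k"
      using that dvd_mult_left dvd_mult_right by blast+
    then have "x ^ k = 1" "y ^ k = 1"
      using x y by (auto simp: is_ord_def)
    then show ?thesis
      by (simp add: power_mult_distrib)
  qed
  ultimately show ?thesis
    using x y by (auto simp: is_ord_def)
qed

lemma is_ord_inj_on:
  fixes x :: "'a::field"
  assumes "is_ord x n"
  shows "inj_on (\<lambda>k. x ^ k) {..<n}"
proof (rule linorder_inj_onI')
  fix i j
  assume ij: "i \<in> {..<n}" "j \<in> {..<n}" "i < j"
  have "x \<noteq> 0"
    using assms by (metis is_ord_def dvd_refl power_0_left not_gr_zero zero_neq_one)
  have "\<not> n dvd j - i"
    using ij by (auto dest: dvd_imp_le)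
  then have "x ^ (j - i) \<noteq> 1"
    using assms by (simp add: is_ord_def)
  moreover have "x ^ j = x ^ i * x ^ (j - i)"
    using ij by (simp flip: power_add)
  ultimately show "x ^ i \<noteq> x ^ j"
    using \<open>x \<noteq> 0\<close> by auto
qed

text \<open>
  Let \<open>x\<close> have the largest order \<open>n\<close> in the group. If the order of some \<open>y\<close> did not divide \<open>n\<close>, a prime
  would occur in it with a larger exponent, and the product of suitable powers of \<open>x\<close> and \<open>y\<close> would
  have an order above \<open>n\<close>. So all elements are roots of \<open>X\<^sup>n - 1\<close>; there are at most \<open>n\<close> of them, and
  the powers of \<open>x\<close> are that many.
\<close>

lemma finite_mult_subgroup_cyclic:
  fixes A :: "'a::field set"
  assumes "finite A" and "1 \<in> A" and "0 \<notin> A" and mult: "\<And>x y. x \<in> A \<Longrightarrow> y \<in> A \<Longrightarrow> x * y \<in> A"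
  obtains x n where "is_ord x n" "A = (\<lambda>k. x ^ k) ` {..<n}"
proof -
  have pow: "x ^ k \<in> A" if "x \<in> A" for x k
    using that assms(2) mult by (induction k) auto
  have ord: "\<exists>n. is_ord x n" if "x \<in> A" for x
  proof -
    have "\<not> inj (\<lambda>k. x ^ k)"
      using pow[OF that] \<open>finite A\<close> finite_subset[of "range (\<lambda>k. x ^ k)" A]
      by (auto dest: finite_imageD)
    then obtain i j where "i < j" "x ^ i = x ^ j"
      unfolding inj_def by (metis linorder_neqE_nat)
    moreover have "x ^ j = x ^ i * x ^ (j - i)"
      using \<open>i < j\<close> by (simp flip: power_add)
    ultimately have "x ^ (j - i) = 1"
      using that \<open>0 \<notin> A\<close> by auto
    with \<open>i < j\<close> show ?thesis
      by (intro is_ord_exists[of _ "j - i"]) simp_all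
  qed
  have card: "n \<le> card A" if "x \<in> A" "is_ord x n" for x n
    using card_mono[OF \<open>finite A\<close>, of "(\<lambda>k. x ^ k) ` {..<n}"] pow[OF that(1)] is_ord_inj_on[OF that(2)]
    by (auto simp: card_image)
  define N where "N = {n. \<exists>x\<in>A. is_ord x n}"
  have "finite N"
    by (rule finite_subset[of _ "{..card A}"]) (auto simp: N_def card)
  moreover have "N \<noteq> {}"
    using ord[OF assms(2)] assms(2) unfolding N_def by blast
  ultimately have "Max N \<in> N" and max: "\<And>n. n \<in> N \<Longrightarrow> n \<le> Max N"
    by (auto intro: Max_in)
  then obtain x n where x: "x \<in> A" "is_ord x n" and n: "n = Max N"
    by (auto simp: N_def)
  have "y ^ n = 1" if y: "y \<in> A" for y
  proof -
    obtain r where r: "is_ord y r"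
      using ord[OF y] by blast
    have "r dvd n"
    proof (rule multiplicity_le_imp_dvd)
      show "r \<noteq> 0"
        using r by (simp add: is_ord_def)
      fix p :: nat
      assume p: "Factorial_Ring.prime p"
      define j k where "j = multiplicity p n" and "k = multiplicity p r"
      have "n > 0" "r > 0"
        using x r by (auto simp: is_ord_def)
      obtain n' where n': "n = p ^ j * n'" "\<not> p dvd n'"
        using multiplicity_decompose'[of n p] \<open>n > 0\<close> prime_gt_1_nat[OF p] unfolding j_def by auto
      obtain r' where r': "r = p ^ k * r'"
        using multiplicity_dvd[of p r] unfolding k_def by (auto elim: dvdE)
      \<comment> \<open>The order of \<open>x\<close> loses its \<open>p\<close>-part, and that of \<open>y\<close> keeps only its \<open>p\<close>-part.\<close>
      have "is_ord (x ^ p ^ j) n'" "is_ord (y ^ r') (p ^ k)"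
        using is_ord_power x(2) r n' r' by (metis mult.commute)+
      moreover have "coprime n' (p ^ k)"
        using prime_imp_coprime[OF p n'(2)] by (simp add: coprime_commute)
      ultimately have "is_ord (x ^ p ^ j * y ^ r') (n' * p ^ k)"
        by (rule is_ord_mult)
      then have "n' * p ^ k \<in> N"
        using mult pow x(1) y by (auto simp: N_def)
      then have "n' * p ^ k \<le> n' * p ^ j"
        using max n n'(1) by (simp add: mult.commute)
      moreover have "n' > 0"
        using n'(2) by (cases n') auto
      ultimately have "p ^ k \<le> p ^ j"
        by simp
      then show "multiplicity p r \<le> multiplicity p n"
        using prime_gt_1_nat[OF p] by (simp flip: j_def k_def)
    qed
    with r show ?thesis by (simp add: is_ord_def)
  qed
  then have "A \<subseteq> {y. poly (monom 1 n - 1) y = 0}"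
    by (auto simp: poly_monom)
  moreover have deg: "degree (monom 1 n - 1 :: 'a poly) = n"
    using x(2) unfolding diff_conv_add_uminus
    by (subst degree_add_eq_left) (auto simp: is_ord_def degree_monom_eq)
  moreover have "monom 1 n - 1 \<noteq> (0 :: 'a poly)"
    using deg x(2) by (auto simp: is_ord_def)
  ultimately have "card A \<le> n"
    using card_mono[OF poly_roots_finite, of "monom 1 n - 1" A]
      card_poly_roots_bound[of "monom 1 n - 1 :: 'a poly"] by linarith
  have sub: "(\<lambda>k. x ^ k) ` {..<n} \<subseteq> A"
    using pow x(1) by auto
  have "card ((\<lambda>k. x ^ k) ` {..<n}) = n"
    using is_ord_inj_on[OF x(2)] by (simp add: card_image)
  with \<open>card A \<le> n\<close> sub have "A = (\<lambda>k. x ^ k) ` {..<n}"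
    using card_seteq[OF \<open>finite A\<close> sub] by simp
  with x(2) show ?thesis
    using that by blast
qed

text \<open>
  Integer exponents suit the model groups, whose elements are pairs with an integer exponent reduced
  modulo the order.
\<close>

lemma is_ord_powi_mod:
  fixes x :: "'a::field"
  assumes "is_ord x n"
  shows "x powi (k mod int n) = x powi k"
proof -
  have "x ^ n = 1"
    using assms by (simp add: is_ord_def)
  moreover have "x \<noteq> 0"
    using assms by (metis is_ord_def dvd_refl power_0_left not_gr_zero zero_neq_one)
  ultimately have "x powi (int n * (k div int n) + k mod int n) = x powi (k mod int n)"
    by (simp only: power_int_add power_int_mult power_int_of_nat simp_thms) simp
  then show ?thesis by simp
qed

lemma is_ord_powi_bij_betw:
  fixes x :: "'a::field"
  assumes "is_ord x n"
  shows "bij_betw (\<lambda>k. x powi k) {0..<int n} ((\<lambda>k. x ^ k) ` {..<n})"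
proof -
  have "bij_betw nat {0..<int n} {..<n}"
    by (rule bij_betw_byWitness[where f' = int]) auto
  then have "bij_betw ((\<lambda>k. x ^ k) \<circ> nat) {0..<int n} ((\<lambda>k. x ^ k) ` {..<n})"
    by (rule bij_betw_trans) (use is_ord_inj_on[OF assms] in \<open>simp add: inj_on_imp_bij_betw\<close>)
  then show ?thesis
    by (rule bij_betw_cong[THEN iffD1, rotated]) (simp add: power_int_def)
qed


section \<open>Finite groups of filtered automorphisms\<close>

lemma generate_subset_subgroup:
  assumes "subgroup H G" and "S \<subseteq> H"
  shows "generate G S \<subseteq> H"
proof
  fix h
  assume "h \<in> generate G S"
  then show "h \<in> H"
    by induction (use assms in \<open>auto intro: subgroup.one_closed subgroup.m_inv_closed subgroup.m_closed\<close>)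
qed

lemma one_filtered_Aut: "\<one>\<^bsub>filtered_Aut a\<^esub> = Theta a 1"
proof -
  have "(\<lambda>r\<in>carrier (gwa a). r) \<in> gwa_alg_auts a"
    by (auto simp: gwa_alg_auts_def id_Bij gwa_plus gwa_times gwa_one elim!: carrier_gwaE
        intro!: ring_hom_memI)
  moreover have "acts_by a (\<lambda>r\<in>carrier (gwa a). r) (theta_sub 1)"
    by (simp add: acts_by_iff)
  ultimately have "(\<lambda>r\<in>carrier (gwa a). r) = Theta a 1"
    using Theta_aut[of 1 a] aut_eqI by (metis one_neq_zero)
  then show ?thesis
    by (simp add: filtered_Aut_def BijGroup_def)
qed

locale finite_filtered_subgroup =
  fixes a :: "'k::field_char_0 poly" and \<rho> :: 'k and H :: "('k free_alg set \<Rightarrow> 'k free_alg set) set"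
  assumes lead: "lead_coeff a = 1" and deg: "degree a \<ge> 3" and root: "poly a 0 = 0"
    and reflective: "reflective_about a \<rho>"
    and sub: "subgroup H (filtered_Aut a)" and fin: "finite H"
begin

abbreviation G where "G \<equiv> filtered_Aut a"
abbreviation T where "T \<equiv> Theta a"
abbreviation S where "S \<equiv> Theta_Omega a \<rho>"

text \<open>
  The scalars of the rescalings in \<open>H\<close>, a finite subgroup of the multiplicative group of the field.
\<close>

definition A where "A = {\<beta>. \<beta> \<noteq> 0 \<and> T \<beta> \<in> H}"

lemma H_mult: "\<phi> \<in> H \<Longrightarrow> \<psi> \<in> H \<Longrightarrow> \<phi> \<otimes>\<^bsub>G\<^esub> \<psi> \<in> H"
  by (rule subgroup.m_closed[OF sub])

lemma H_cases:
  assumes "\<phi> \<in> H"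
  obtains \<beta> where "\<beta> \<in> A" "\<phi> = T \<beta>" | \<beta> where "\<beta> \<noteq> 0" "\<phi> = S \<beta>"
  using filtered_Aut_cases[OF lead deg root reflective, of \<phi>] assms subgroup.mem_carrier[OF sub]
  unfolding A_def by blast

lemma A_cyclic:
  obtains x N where "is_ord x N" "x \<noteq> 0" "bij_betw (\<lambda>k. x powi k) {0..<int N} A"
proof -
  have "inj_on T A"
    by (rule inj_onI) (auto simp: A_def dest: Theta_inj)
  moreover have "T ` A \<subseteq> H"
    by (auto simp: A_def)
  ultimately have "finite A"
    using fin finite_imageD finite_subset by metis
  moreover have one: "1 \<in> A"
    using subgroup.one_closed[OF sub] by (simp add: A_def one_filtered_Aut)
  moreover have "0 \<notin> A"
    by (simp add: A_def)
  moreover have "\<beta> * \<gamma> \<in> A" if "\<beta> \<in> A" "\<gamma> \<in> A" for \<beta> \<gamma>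
    using that H_mult[of "T \<beta>" "T \<gamma>"] by (simp add: A_def Theta_mult_Theta)
  ultimately obtain x N where x: "is_ord x N" and A: "A = (\<lambda>k. x ^ k) ` {..<N}"
    by (rule finite_mult_subgroup_cyclic)
  have "x \<noteq> 0"
    using x by (metis is_ord_def dvd_refl power_0_left not_gr_zero zero_neq_one)
  with x A is_ord_powi_bij_betw[OF x] show ?thesis
    using that by simp
qed

lemma Theta_power_in_generate:
  assumes "x \<noteq> 0" and "T x \<in> Q" and "k \<ge> 0"
  shows "T (x powi k) \<in> generate G Q"
proof -
  have "T (x ^ j) \<in> generate G Q" for j
  proof (induction j)
    case 0
    then show ?case
      using generate.one[of G Q] by (simp add: one_filtered_Aut)
  next
    case (Suc j)
    then show ?case
      using generate.eng[OF generate.incl[OF assms(2)] Suc] assms(1)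
      by (simp add: Theta_mult_Theta)
  qed
  with assms(3) show ?thesis
    by (simp add: power_int_def)
qed

lemma cyclic_case:
  assumes "is_ord x N" "x \<noteq> 0" and bij: "bij_betw (\<lambda>k. x powi k) {0..<int N} A"
    and no_S: "\<And>\<beta>. \<beta> \<noteq> 0 \<Longrightarrow> S \<beta> \<notin> H"
  shows "H = generate G {T x}" and "G\<lparr>carrier := H\<rparr> \<cong> integer_mod_group N"
proof -
  have N: "N > 0"
    using assms(1) by (simp add: is_ord_def)
  have H: "H = T ` A"
  proof
    show "H \<subseteq> T ` A"
      using no_S by (blast elim: H_cases)
  qed (auto simp: A_def)
  have A: "A = (\<lambda>k. x powi k) ` {0..<int N}"
    using bij by (simp add: bij_betw_def)
  have "x \<in> A"
    using bij_betwE[OF bij, rule_format, of "1 mod int N"] is_ord_powi_mod[OF assms(1), of 1] N by simp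
  then have "generate G {T x} \<subseteq> H"
    by (intro generate_subset_subgroup[OF sub]) (simp add: A_def)
  moreover have "H \<subseteq> generate G {T x}"
  proof
    fix \<phi>
    assume "\<phi> \<in> H"
    then obtain \<beta> where \<beta>: "\<phi> = T \<beta>" "\<beta> \<in> A"
      using H by blast
    from \<beta>(2) obtain k where "\<beta> = x powi k" "k \<in> {0..<int N}"
      unfolding A ..
    with \<beta>(1) have "\<phi> = T (x powi k)" "k \<ge> 0"
      by simp_all
    then show "\<phi> \<in> generate G {T x}"
      using assms(2) by (simp add: Theta_power_in_generate)
  qed
  ultimately show "H = generate G {T x}" by (rule equalityI[rotated])
  have "inj_on T A"
    by (rule inj_onI) (auto simp: A_def dest: Theta_inj)
  then have "bij_betw T A H"
    using H[symmetric] by (rule bij_betw_imageI)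
  then have bij_H: "bij_betw (\<lambda>k. T (x powi k)) {0..<int N} H"
    using bij_betw_trans[OF bij] by (simp add: o_def)
  have "T (x powi i) \<otimes>\<^bsub>G\<^esub> T (x powi j) = T (x powi ((i + j) mod int N))" for i j
    using assms(1,2) by (simp add: Theta_mult_Theta is_ord_powi_mod power_int_add)
  then have "(\<lambda>k. T (x powi k)) \<in> iso (integer_mod_group N) (G\<lparr>carrier := H\<rparr>)"
    using N bij_H bij_betw_imp_funcset[OF bij_H] by (simp add: iso_def hom_def carrier_integer_mod_group)
  then have "integer_mod_group N \<cong> G\<lparr>carrier := H\<rparr>"
    by (auto simp: is_iso_def)
  then show "G\<lparr>carrier := H\<rparr> \<cong> integer_mod_group N"
    by (rule group.iso_sym[OF group_integer_mod_group])
qed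

text \<open>
  The elements \<open>\<Theta>\<^sub>\<beta> \<circ> \<Omega>\<close> of \<open>H\<close> form a single coset of the subgroup of rescalings, which contains
  their squares \<open>\<Theta>\<^sub>\<epsilon>\<close>.
\<close>

lemma S_mult_closed:
  assumes "\<beta> \<noteq> 0" "S \<beta> \<in> H"
  shows "(- 1) ^ degree a \<in> A" and "\<gamma> \<in> A \<Longrightarrow> S (\<gamma> * \<beta>) \<in> H"
    and "\<gamma> \<noteq> 0 \<Longrightarrow> S \<gamma> \<in> H \<Longrightarrow> \<gamma> / \<beta> \<in> A"
proof -
  have *: "(- 1) ^ degree a * \<gamma> / \<beta> \<in> A" if "\<gamma> \<noteq> 0" "S \<gamma> \<in> H" for \<gamma>
    using H_mult[OF that(2) assms(2)] that(1) assms(1) reflective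
    by (simp add: A_def Theta_Omega_mult_Theta_Omega)
  show e: "(- 1) ^ degree a \<in> A"
    using *[OF assms] assms(1) by simp
  show "S (\<gamma> * \<beta>) \<in> H" if "\<gamma> \<in> A"
    using H_mult[of "T \<gamma>" "S \<beta>"] that assms reflective by (simp add: A_def Theta_mult_Theta_Omega)
  assume "\<gamma> \<noteq> 0" "S \<gamma> \<in> H"
  then have "T ((- 1) ^ degree a) \<otimes>\<^bsub>G\<^esub> T ((- 1) ^ degree a * \<gamma> / \<beta>) \<in> H"
    using e * by (intro H_mult) (auto simp: A_def)
  then show "\<gamma> / \<beta> \<in> A"
    using \<open>\<gamma> \<noteq> 0\<close> assms(1)
    by (simp add: A_def Theta_mult_Theta minus_one_power_square flip: mult.assoc)
qed

text \<open>
  The group law on pairs \<open>(i, e)\<close>, standing for \<open>r\<^sup>i s\<^sup>e\<close> with \<open>r\<^sup>N = 1\<close>, \<open>s r s\<^sup>-\<^sup>1 = r\<^sup>-\<^sup>1\<close> and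
  \<open>s\<^sup>2 = r\<^sup>c\<close>, covers the dihedral group (\<open>c = 0\<close>) and the binary dihedral group (\<open>N = 2m\<close>, \<open>c = m\<close>) at
  once. Here \<open>r = \<Theta>\<^sub>x\<close> and \<open>s = \<Theta>\<^sub>\<beta> \<circ> \<Omega>\<close>, and \<open>c\<close> is determined by \<open>s\<^sup>2 = \<Theta>\<^sub>\<epsilon>\<close>.
\<close>

lemma noncyclic_case:
  assumes x: "is_ord x N" "x \<noteq> 0" and bij: "bij_betw (\<lambda>k. x powi k) {0..<int N} A"
    and \<beta>: "\<beta> \<noteq> 0" "S \<beta> \<in> H" and c: "x powi c = (- 1) ^ degree a"
    and K: "group K" "carrier K = {0..<int N} \<times> {0, 1}"
    "\<And>i e j f. monoid.mult K (i, e) (j, f)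
      = ((i + (- 1) ^ e * j + c * int e * int f) mod int N, (e + f) mod 2)"
  shows "H = generate G {S \<beta>, T x}" and "G\<lparr>carrier := H\<rparr> \<cong> K"
proof -
  let ?Q = "{S \<beta>, T x}"
  have N: "N > 0"
    using x by (simp add: is_ord_def)
  have A: "A = (\<lambda>k. x powi k) ` {0..<int N}"
    using bij by (simp add: bij_betw_def)
  have "x \<in> A"
    using bij_betwE[OF bij, rule_format, of "1 mod int N"] is_ord_powi_mod[OF x(1), of 1] N by simp
  define \<psi> where "\<psi> = (\<lambda>(i, e). if e = (0::nat) then T (x powi i) else S (x powi i * \<beta>))"
  have in_H: "\<psi> (i, e) \<in> H" if "i \<in> {0..<int N}" for i e
  proof -
    have "x powi i \<in> A"
      using that A by blast
    then show ?thesis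
      using S_mult_closed(2)[OF \<beta>] by (auto simp: \<psi>_def A_def)
  qed
  have "\<phi> \<in> \<psi> ` ({0..<int N} \<times> {0, 1})" if "\<phi> \<in> H" for \<phi>
    using that
  proof (cases rule: H_cases)
    case (1 \<gamma>)
    then obtain i where "i \<in> {0..<int N}" "\<gamma> = x powi i"
      using A by blast
    with 1 show ?thesis
      by (intro image_eqI[of _ _ "(i, 0)"]) (auto simp: \<psi>_def)
  next
    case (2 \<gamma>)
    then have "\<gamma> / \<beta> \<in> A"
      using that S_mult_closed(3)[OF \<beta>] by blast
    then obtain i where "i \<in> {0..<int N}" "\<gamma> / \<beta> = x powi i"
      using A by blast
    with 2 \<beta>(1) show ?thesis
      by (intro image_eqI[of _ _ "(i, 1)"]) (auto simp: \<psi>_def field_simps)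
  qed
  then have img: "\<psi> ` ({0..<int N} \<times> {0, 1}) = H"
    using in_H by auto
  have "inj_on \<psi> ({0..<int N} \<times> {0, 1})"
  proof (rule inj_onI)
    fix u v
    assume uv: "u \<in> {0..<int N} \<times> {0::nat, 1}" "v \<in> {0..<int N} \<times> {0::nat, 1}" "\<psi> u = \<psi> v"
    obtain i e j f where [simp]: "u = (i, e)" "v = (j, f)"
      by (cases u, cases v)
    have nz: "x powi k \<noteq> 0" "x powi k * \<beta> \<noteq> 0" for k
      using x(2) \<beta>(1) by simp_all
    have "e = f"
      using uv Theta_neq_Theta_Omega[OF reflective] nz by (auto simp: \<psi>_def split: if_splits; metis)
    moreover have "x powi i = x powi j"
      using uv Theta_inj[OF _ nz(1) nz(1)] Theta_Omega_inj[OF reflective _ _ nz(2) nz(2)] lead \<beta>(1) \<open>e = f\<close>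
      by (fastforce simp: \<psi>_def split: if_splits)
    then have "i = j"
      using bij uv by (auto simp: bij_betw_def dest: inj_onD)
    ultimately show "u = v" by simp
  qed
  then have bij_\<psi>: "bij_betw \<psi> ({0..<int N} \<times> {0, 1}) H"
    using img by (simp add: bij_betw_def)
  have mult: "\<psi> (i, e) \<otimes>\<^bsub>G\<^esub> \<psi> (j, f)
      = \<psi> ((i + (- 1) ^ e * j + c * int e * int f) mod int N, (e + f) mod 2)"
    if "e \<in> {0, 1}" "f \<in> {0, 1}" for i e j f
    using that x(2) \<beta>(1) reflective
    by (auto simp: \<psi>_def is_ord_powi_mod[OF x(1)] power_int_add power_int_diff c Theta_mult_Theta
        Theta_mult_Theta_Omega Theta_Omega_mult_Theta Theta_Omega_mult_Theta_Omega power_int_minus field_simps)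
  have "\<psi> \<in> iso K (G\<lparr>carrier := H\<rparr>)"
    using bij_\<psi> in_H mult by (auto simp: iso_def hom_def K(2,3))
  then have "K \<cong> G\<lparr>carrier := H\<rparr>"
    by (auto simp: is_iso_def)
  then show "G\<lparr>carrier := H\<rparr> \<cong> K"
    by (rule group.iso_sym[OF K(1)])
  have "\<psi> (i, e) \<in> generate G ?Q" if "i \<ge> 0" for i e
  proof -
    have "T (x powi i) \<in> generate G ?Q"
      using that x(2) by (intro Theta_power_in_generate) auto
    moreover from this have "T (x powi i) \<otimes>\<^bsub>G\<^esub> S \<beta> \<in> generate G ?Q"
      by (rule generate.eng) (simp add: generate.incl)
    ultimately show ?thesis
      using x(2) \<beta>(1) reflective by (simp add: \<psi>_def Theta_mult_Theta_Omega)
  qed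
  then have "H \<subseteq> generate G ?Q"
    unfolding img[symmetric] by auto
  moreover have "generate G ?Q \<subseteq> H"
    using \<beta>(2) \<open>x \<in> A\<close> by (intro generate_subset_subgroup[OF sub]) (auto simp: A_def)
  ultimately show "H = generate G ?Q" by (rule equalityI)
qed

lemma dihedral_case:
  assumes "even (degree a)" and x: "is_ord x N" "x \<noteq> 0" and bij: "bij_betw (\<lambda>k. x powi k) {0..<int N} A"
    and \<beta>: "\<beta> \<noteq> 0" "S \<beta> \<in> H"
  shows "H = generate G {S \<beta>, T x}" and "G\<lparr>carrier := H\<rparr> \<cong> dihedral_group N"
proof -
  have "N > 0"
    using x by (simp add: is_ord_def)
  then have K: "group (dihedral_group N)"
    by (rule group_dihedral_group)
  have c: "x powi 0 = (- 1) ^ degree a"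
    using assms(1) by simp
  have carrier: "carrier (dihedral_group N) = {0..<int N} \<times> {0, 1}"
    by (simp add: dihedral_group_def)
  have mult: "monoid.mult (dihedral_group N) (i, e) (j, f)
      = ((i + (- 1) ^ e * j + 0 * int e * int f) mod int N, (e + f) mod 2)" for i e j f
    by (simp add: dihedral_group_def)
  show "H = generate G {S \<beta>, T x}" and "G\<lparr>carrier := H\<rparr> \<cong> dihedral_group N"
    by (rule noncyclic_case[OF x bij \<beta> c K carrier mult])+
qed

text \<open>
  The scalar \<open>-1\<close> belongs to the cyclic group generated by \<open>x\<close>, so the order of \<open>x\<close> is even and
  \<open>-1\<close> is the power of \<open>x\<close> to half that order.
\<close>

lemma binary_dihedral_case:
  assumes "odd (degree a)" and x: "is_ord x N" "x \<noteq> 0" and bij: "bij_betw (\<lambda>k. x powi k) {0..<int N} A"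
    and \<beta>: "\<beta> \<noteq> 0" "S \<beta> \<in> H"
  obtains m where "N = 2 * m" "m > 0" "H = generate G {S \<beta>, T x}"
    "G\<lparr>carrier := H\<rparr> \<cong> binary_dihedral_group m"
proof -
  have "- 1 \<in> A"
    using S_mult_closed(1)[OF \<beta>] assms(1) by simp
  then have "- 1 \<in> (\<lambda>k. x powi k) ` {0..<int N}"
    unfolding bij_betw_imp_surj_on[OF bij] .
  then obtain k where "k \<in> {0..<int N}" "- 1 = x powi k" ..
  then have k: "x ^ nat k = - 1"
    by (simp add: power_int_def)
  then have "x ^ (2 * nat k) = 1"
    by (simp add: power_mult power2_eq_square mult.commute[of 2])
  moreover have "x ^ nat k \<noteq> 1"
    using k by simp
  ultimately have "N dvd 2 * nat k" "\<not> N dvd nat k"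
    using x(1) unfolding is_ord_def by blast+
  then have "even N"
    using coprime_dvd_mult_right_iff[of N 2 "nat k"] by (auto simp: coprime_commute)
  then obtain m where m: "N = 2 * m"
    by blast
  have "m > 0"
    using x(1) m by (simp add: is_ord_def)
  have "x ^ (2 * m) = 1" "x ^ m \<noteq> 1"
    using x(1) \<open>m > 0\<close> by (auto simp: is_ord_def m dest: dvd_imp_le)
  then have "x ^ m = - 1"
    by (metis power_even_eq power2_eq_1_iff)
  then have c: "x powi int m = (- 1) ^ degree a"
    using assms(1) by simp
  have carrier: "carrier (binary_dihedral_group m) = {0..<int N} \<times> {0, 1}"
    by (simp add: binary_dihedral_group_def m)
  have mult: "monoid.mult (binary_dihedral_group m) (i, e) (j, f)
      = ((i + (- 1) ^ e * j + int m * int e * int f) mod int N, (e + f) mod 2)" for i e j f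
    by (simp add: binary_dihedral_group_def m)
  have "H = generate G {S \<beta>, T x}" "G\<lparr>carrier := H\<rparr> \<cong> binary_dihedral_group m"
    by (rule noncyclic_case[OF x bij \<beta> c group_binary_dihedral_group[OF \<open>m > 0\<close>] carrier mult])+
  with m \<open>m > 0\<close> show ?thesis
    using that by blast
qed

end


theorem theorem3p1:
  fixes a :: "'k::{alg_closed_field, field_char_0} poly"
    and \<rho> :: 'k
    and n :: nat
    and H :: "('k free_alg set \<Rightarrow> 'k free_alg set) set"
  assumes "lead_coeff a = 1"
    and "degree a = n"
    and "n \<ge> 3"
    and "poly a 0 = 0"
    and "reflective_about a \<rho>"
    and "subgroup H (filtered_Aut a)"
    and "finite H"
    and "H \<noteq> {\<one>\<^bsub>filtered_Aut a\<^esub>}"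
  shows
    "(even n \<longrightarrow>
        (\<exists>\<beta>. \<beta> \<noteq> 0 \<and> H = generate (filtered_Aut a) {Theta_Omega a \<rho> \<beta>}
           \<and> (filtered_Aut a)\<lparr>carrier := H\<rparr> \<cong> integer_mod_group 2)
      \<or> (\<exists>\<mu> m. m > 0 \<and> \<mu> \<noteq> 0 \<and> \<mu> ^ m = 1 \<and> H = generate (filtered_Aut a) {Theta a \<mu>}
           \<and> (filtered_Aut a)\<lparr>carrier := H\<rparr> \<cong> integer_mod_group m)
      \<or> (\<exists>\<beta> \<mu> m. m > 0 \<and> \<beta> \<noteq> 0 \<and> \<mu> \<noteq> 0 \<and> \<mu> ^ m = 1
           \<and> H = generate (filtered_Aut a) {Theta_Omega a \<rho> \<beta>, Theta a \<mu>}
           \<and> (filtered_Aut a)\<lparr>carrier := H\<rparr> \<cong> dihedral_group m))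
   \<and> (odd n \<longrightarrow>
        (\<exists>\<beta>. \<beta> \<noteq> 0 \<and> H = generate (filtered_Aut a) {Theta_Omega a \<rho> \<beta>}
           \<and> (filtered_Aut a)\<lparr>carrier := H\<rparr> \<cong> integer_mod_group 4)
      \<or> (\<exists>\<mu> m. m > 0 \<and> \<mu> \<noteq> 0 \<and> \<mu> ^ m = 1 \<and> H = generate (filtered_Aut a) {Theta a \<mu>}
           \<and> (filtered_Aut a)\<lparr>carrier := H\<rparr> \<cong> integer_mod_group m)
      \<or> (\<exists>\<beta> \<mu> m. m > 0 \<and> \<beta> \<noteq> 0 \<and> \<mu> \<noteq> 0 \<and> \<mu> ^ (2 * m) = 1
           \<and> H = generate (filtered_Aut a) {Theta_Omega a \<rho> \<beta>, Theta a \<mu>}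
           \<and> (filtered_Aut a)\<lparr>carrier := H\<rparr> \<cong> binary_dihedral_group m))"
proof -
  interpret finite_filtered_subgroup a \<rho> H
    by (rule finite_filtered_subgroup.intro) (use assms in simp_all)
  obtain \<mu> N where \<mu>: "is_ord \<mu> N" "\<mu> \<noteq> 0" and bij: "bij_betw (\<lambda>k. \<mu> powi k) {0..<int N} A"
    by (rule A_cyclic)
  have N: "N > 0" "\<mu> ^ N = 1"
    using \<mu>(1) by (simp_all add: is_ord_def)
  show ?thesis
  proof (cases "\<exists>\<beta>. \<beta> \<noteq> 0 \<and> S \<beta> \<in> H")
    case False
    then show ?thesis
      using cyclic_case[OF \<mu> bij] \<mu>(2) N by blast
  next
    case True
    \<comment> \<open>A group \<open>\<langle>\<Theta>\<^sub>\<beta> \<circ> \<Omega>\<rangle>\<close> falls under the dihedral or binary dihedral alternative with \<open>m = 1\<close>, as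
    \<open>D\<^sub>2 = C\<^sub>2\<close> and \<open>Dic\<^sub>1 = C\<^sub>4\<close>.\<close>
    then obtain \<beta> where \<beta>: "\<beta> \<noteq> 0" "S \<beta> \<in> H"
      by blast
    show ?thesis
    proof (cases "even n")
      case True
      then show ?thesis
        using dihedral_case[OF _ \<mu> bij \<beta>] assms(2) \<beta>(1) \<mu>(2) N by blast
    next
      case False
      then obtain m where "N = 2 * m" "m > 0" "H = generate G {S \<beta>, T \<mu>}"
        "G\<lparr>carrier := H\<rparr> \<cong> binary_dihedral_group m"
        using binary_dihedral_case[OF _ \<mu> bij \<beta>] assms(2) by blast
      then show ?thesis
        using False \<beta>(1) \<mu>(2) N by blast
    qed
  qed
qed

end
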